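(* Let $n\ge2$, let $\omega=(w_1,\dots,w_n)\in\Delta_n$, and let $G_n=G_n(\omega;\cdot):\mathbb{P}^n\to\mathbb{P}$ be a weighted $n$-mean satisfying the weighted arithmetic-$G_n$-harmonic mean inequalities for the near-order: $$\mathcal{H}(\omega;\mathbb{A})\preceq G_n(\omega;\mathbb{A})\preceq\mathcal{A}(\omega;\mathbb{A})\quad\text{for all }\mathbb{A}\in\mathbb{P}^n.$$ Then $G_n$ is a multivariable Lie-Trotter mean.
   Context: $\mathbb{P}$ is the open convex cone of positive definite (positive and invertible) bounded linear operators on a Hilbert space. The Loewner order $X \le Y$ on self-adjoint operators means $Y - X$ is positive semi-definite. The metric geometric mean is $A \# B = A^{1/2}(A^{-1/2} B A^{-1/2})^{1/2}A^{1/2}$ for $A,B\in\mathbb{P}$. The near-order on $\mathbb{P}$ is defined by: $A \preceq B$ if and only if $A^{-1}\# B \ge I$. $\Delta_n$ is the set of probability vectors in $\mathbb{R}^n$ with all entries positive. For $\mathbb{A}=(A_1,\dots,A_n)\in\mathbb{P}^n$, $\mathcal{A}(\omega;\mathbb{A})=\sum_{j=1}^n w_jA_j$ and $\mathcal{H}(\omega;\mathbb{A})=\left(\sum_{j=1}^n w_jA_j^{-1}\right)^{-1}$. A weighted $n$-mean is a map $G_n=G_n(\omega;\cdot):\mathbb{P}^n\to\mathbb{P}$ that is idempotent: $G_n(\omega;X,\dots,X)=X$ for all $X\in\mathbb{P}$. A weighted $n$-mean $G_n$ is a multivariable Lie-Trotter mean if it is differentiable and satisfies $$\lim_{s\to0}G_n(\omega;\gamma_1(s),\dots,\gamma_n(s))^{1/s}=\exp\left(\sum_{j=1}^n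 w_j\gamma_j'(0)\right)$$ for all differentiable curves $\gamma_i:(-\epsilon,\epsilon)\to\mathbb{P}$ ($\epsilon>0$) with $\gamma_i(0)=I$ for all $i$.
   Formalization: "Differentiable" in the conclusion is proved only at constant tuples (X,…,X), relative to P^n: on all of P^n the claim is false, e.g. G equal to the arithmetic mean except at one non-constant tuple, where it is the harmonic mean. The limit formula is proved in full. *)

theory Defs
  imports "HOL-Analysis.Analysis"
begin

text \<open>Complex Hilbert spaces; the inner product is linear in its first argument. Positivity and
  definiteness of \<open>cinner\<close> follow from \<open>norm_eq_sqrt_cinner\<close>, since \<open>sqrt\<close> is odd and \<open>norm\<close> is a
  norm; completeness comes from \<open>banach\<close>. The zero space is included.\<close>

class complex_hilbert_space = banach +
  fixes scaleC :: "complex \<Rightarrow> 'a \<Rightarrow> 'a" (infixr "*\<^sub>C" 75)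
    and cinner :: "'a \<Rightarrow> 'a \<Rightarrow> complex"
  assumes scaleC_add_right: "c *\<^sub>C (x + y) = c *\<^sub>C x + c *\<^sub>C y"
    and scaleC_add_left: "(c + d) *\<^sub>C x = c *\<^sub>C x + d *\<^sub>C x"
    and scaleC_scaleC: "c *\<^sub>C d *\<^sub>C x = (c * d) *\<^sub>C x"
    and scaleC_of_real: "complex_of_real r *\<^sub>C x = r *\<^sub>R x"
    and cinner_commute: "cinner x y = cnj (cinner y x)"
    and cinner_add_left: "cinner (x + y) z = cinner x z + cinner y z"
    and cinner_scaleC_left: "cinner (c *\<^sub>C x) y = c * cinner x y"
    and norm_eq_sqrt_cinner: "norm x = sqrt (Re (cinner x x))"

instantiation complex :: complex_hilbert_space
begin

definition scaleC_complex :: "complex \<Rightarrow> complex \<Rightarrow> complex"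
  where "scaleC_complex c x = c * x"

definition cinner_complex :: "complex \<Rightarrow> complex \<Rightarrow> complex"
  where "cinner_complex x y = x * cnj y"

instance
  by standard
    (simp_all add: scaleC_complex_def cinner_complex_def algebra_simps scaleR_conv_of_real
      cmod_def power2_eq_square)

end

text \<open>The type \<open>'a \<Rightarrow>\<^sub>L 'a\<close> consists of the real-linear bounded operators, with the operator norm; a
  bounded operator on the complex Hilbert space is one that also commutes with complex scalars.\<close>

type_synonym 'a oper = "'a \<Rightarrow>\<^sub>L 'a"

definition complex_linear_op :: "'a::complex_hilbert_space oper \<Rightarrow> bool"
  where "complex_linear_op A \<longleftrightarrow>
    (\<forall>c x. blinfun_apply A (c *\<^sub>C x) = c *\<^sub>C blinfun_apply A x)"

definition self_adjoint :: "'a::complex_hilbert_space oper \<Rightarrow> bool"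
  where "self_adjoint A \<longleftrightarrow> complex_linear_op A \<and>
    (\<forall>x y. cinner (blinfun_apply A x) y = cinner x (blinfun_apply A y))"

definition pos_semidef :: "'a::complex_hilbert_space oper \<Rightarrow> bool"
  where "pos_semidef A \<longleftrightarrow> self_adjoint A \<and> (\<forall>x. 0 \<le> Re (cinner (blinfun_apply A x) x))"

definition loewner_le :: "'a::complex_hilbert_space oper \<Rightarrow> 'a oper \<Rightarrow> bool"
    (infix "\<le>\<^sub>L" 50)
  where "X \<le>\<^sub>L Y \<longleftrightarrow> pos_semidef (Y - X)"

definition op_invertible :: "'a::complex_hilbert_space oper \<Rightarrow> bool"
  where "op_invertible A \<longleftrightarrow> (\<exists>B. A o\<^sub>L B = id_blinfun \<and> B o\<^sub>L A = id_blinfun)"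

definition op_inv :: "'a::complex_hilbert_space oper \<Rightarrow> 'a oper"
  where "op_inv A = (THE B. A o\<^sub>L B = id_blinfun \<and> B o\<^sub>L A = id_blinfun)"

definition PD :: "'a::complex_hilbert_space oper set"
  where "PD = {A. pos_semidef A \<and> op_invertible A}"

definition op_sqrt :: "'a::complex_hilbert_space oper \<Rightarrow> 'a oper"
  where "op_sqrt A = (THE B. pos_semidef B \<and> B o\<^sub>L B = A)"

text \<open>The library's \<open>exp\<close> needs a \<open>real_normed_algebra_1\<close>, which \<open>'a \<Rightarrow>\<^sub>L 'a\<close> is not an instance of.
  Real powers of a positive definite operator are \<open>A\<^sup>r = exp (r log A)\<close>, where \<open>log A\<close> is the unique
  self-adjoint logarithm.\<close>

definition op_exp :: "'a::complex_hilbert_space oper \<Rightarrow> 'a oper"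
  where "op_exp A = (\<Sum>k. (1 / fact k) *\<^sub>R ((\<lambda>B. A o\<^sub>L B) ^^ k) id_blinfun)"

definition op_log :: "'a::complex_hilbert_space oper \<Rightarrow> 'a oper"
  where "op_log A = (THE L. self_adjoint L \<and> op_exp L = A)"

definition op_powr :: "'a::complex_hilbert_space oper \<Rightarrow> real \<Rightarrow> 'a oper"
  where "op_powr A r = op_exp (r *\<^sub>R op_log A)"

definition geo_mean :: "'a::complex_hilbert_space oper \<Rightarrow> 'a oper \<Rightarrow> 'a oper"
  where "geo_mean A B =
    op_sqrt A o\<^sub>L op_sqrt (op_inv (op_sqrt A) o\<^sub>L B o\<^sub>L op_inv (op_sqrt A)) o\<^sub>L op_sqrt A"

definition near_le :: "'a::complex_hilbert_space oper \<Rightarrow> 'a oper \<Rightarrow> bool"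
    (infix "\<preceq>\<^sub>N" 50)
  where "A \<preceq>\<^sub>N B \<longleftrightarrow> id_blinfun \<le>\<^sub>L geo_mean (op_inv A) B"

definition prob_vectors :: "(real ^ 'n) set"
  where "prob_vectors = {w. (\<forall>i. 0 < w $ i) \<and> (\<Sum>i\<in>UNIV. w $ i) = 1}"

definition PD_tuples :: "('a::complex_hilbert_space oper ^ 'n) set"
  where "PD_tuples = {A. \<forall>i. A $ i \<in> PD}"

definition arith_mean :: "real ^ 'n \<Rightarrow> 'a::complex_hilbert_space oper ^ 'n \<Rightarrow> 'a oper"
  where "arith_mean w A = (\<Sum>i\<in>UNIV. w $ i *\<^sub>R A $ i)"

definition harm_mean :: "real ^ 'n \<Rightarrow> 'a::complex_hilbert_space oper ^ 'n \<Rightarrow> 'a oper"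
  where "harm_mean w A = op_inv (\<Sum>i\<in>UNIV. w $ i *\<^sub>R op_inv (A $ i))"

text \<open>Means are total functions of which only the values on \<open>PD_tuples\<close> matter.\<close>

definition weighted_mean :: "('a::complex_hilbert_space oper ^ 'n \<Rightarrow> 'a oper) \<Rightarrow> bool"
  where "weighted_mean G \<longleftrightarrow>
    (\<forall>A\<in>PD_tuples. G A \<in> PD) \<and> (\<forall>X\<in>PD. G (\<chi> i. X) = X)"

text \<open>``Differentiable'' is Frechet differentiability, relative to \<open>PD_tuples\<close> (open in the space of
  tuples of self-adjoint operators), at every constant tuple \<open>(X, \<dots>, X)\<close>, in particular at the
  identity tuple through which the curves pass. It cannot be asked at other tuples \<open>A\<close> if means
  lying between the harmonic and the arithmetic one are to qualify: the two bounds are distinct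
  there, and a mean may jump between them.\<close>

definition lie_trotter_mean ::
    "real ^ 'n \<Rightarrow> ('a::complex_hilbert_space oper ^ 'n \<Rightarrow> 'a oper) \<Rightarrow> bool"
  where "lie_trotter_mean w G \<longleftrightarrow>
    weighted_mean G \<and>
    (\<forall>X\<in>PD. G differentiable (at (\<chi> i. X) within PD_tuples)) \<and>
    (\<forall>\<epsilon>>0. \<forall>\<gamma> :: 'n \<Rightarrow> real \<Rightarrow> 'a oper.
      (\<forall>i. \<gamma> i 0 = id_blinfun \<and>
           (\<forall>s\<in>{-\<epsilon><..<\<epsilon>}. \<gamma> i s \<in> PD \<and> \<gamma> i differentiable (at s))) \<longrightarrow>
      ((\<lambda>s. op_powr (G (\<chi> i. \<gamma> i s)) (1 / s))
        \<longlongrightarrow> op_exp (\<Sum>i\<in>UNIV. w $ i *\<^sub>R vector_derivative (\<gamma> i) (at 0))) (at 0))"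

end

theory Submission
  imports Defs
begin

text \<open>
  Let \<open>M\<close> and \<open>H\<close> be the arithmetic and the harmonic mean of a tuple \<open>A\<close>.  The near-order
  \<open>H \<preceq>\<^sub>N G\<close> says that \<open>G = Z H Z\<close> for some \<open>Z \<ge> 1\<close>, because \<open>Z = H\<^sup>-\<^sup>1 # G\<close> solves this
  Riccati equation (\<open>near_leD\<close>); likewise \<open>M = W G W\<close> with \<open>W \<ge> 1\<close>.  With
  \<open>D = W\<^sup>-\<^sup>1 \<le> 1 \<le> Z\<close> the two equations combine to \<open>Z H Z - D H D = D (M - H) D\<close>.  The left side
  is half of \<open>S H T + T H S\<close>, where \<open>S = Z + D\<close> and \<open>T = Z - D \<ge> 0\<close>, so it is a Lyapunov operator
  applied to \<open>T\<close>.  Such an operator is bounded below on self-adjoint operators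
  (\<open>Lyapunov_bound\<close>).  Hence \<open>T\<close>, therefore also \<open>Z - 1 \<le> T\<close> and finally \<open>G - H\<close>, are bounded by
  a constant times \<open>\<parallel>M - H\<parallel>\<close> (\<open>near_order_sandwich_norm_le\<close>).  The constant depends only on a
  lower bound of \<open>H\<close> and upper bounds of \<open>H\<close> and \<open>M\<close>.

  Near a constant tuple \<open>X\<close> the means \<open>M\<close> and \<open>H\<close> differ only to second order
  (\<open>arith_harm_mean_bounds\<close>).  So \<open>G\<close> differs from the linear map \<open>M\<close> only to second order, and
  \<open>M\<close> is the derivative of \<open>G\<close> there (\<open>near_order_mean_has_derivative\<close>).  At \<open>X = 1\<close> the chain
  rule shows that \<open>F(s) = G(\<gamma>\<^sub>1(s), \<dots>, \<gamma>\<^sub>n(s))\<close> has the velocity \<open>\<Sum> w\<^sub>i \<gamma>\<^sub>i'(0)\<close> at \<open>0\<close>.  As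
  \<open>log A\<close> is \<open>A - 1\<close> up to second order (\<open>op_log_near_id\<close>), \<open>log F(s) / s\<close> tends to this velocity,
  and the exponential is continuous.

  The same Lyapunov bound gives the uniqueness of positive square roots, and from this follows the
  uniqueness of self-adjoint logarithms.  Inverses, square roots and logarithms near \<open>1\<close> are all
  constructed as fixed points of contractions.
\<close>

section \<open>Operators and the real inner product\<close>

text \<open>Operators are real-linear maps, and positivity only involves real parts.  The real part of
  the inner product is symmetric and real-bilinear, which keeps conjugations out of the estimates.\<close>

definition rinner :: "'a::complex_hilbert_space \<Rightarrow> 'a \<Rightarrow> real"
  where "rinner x y = Re (cinner x y)"

lemma cinner_add_right: "cinner x (y + z) = cinner x y + cinner x z"
  by (metis cinner_add_left cinner_commute complex_cnj_add)

lemma cinner_scaleC_right: "cinner x (c *\<^sub>C y) = cnj c * cinner x y"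
  by (metis cinner_commute cinner_scaleC_left complex_cnj_mult)

lemma cinner_scaleR_left: "cinner (r *\<^sub>R x) y = of_real r * cinner x y"
  by (metis cinner_scaleC_left scaleC_of_real)

lemma cinner_scaleR_right: "cinner x (r *\<^sub>R y) = of_real r * cinner x y"
  by (metis cinner_scaleC_right scaleC_of_real complex_cnj_complex_of_real)

lemma rinner_commute: "rinner x y = rinner y x"
  unfolding rinner_def by (metis cinner_commute complex_cnj cnj.simps(1))

lemma rinner_add_left: "rinner (x + y) z = rinner x z + rinner y z"
  by (simp add: rinner_def cinner_add_left)

lemma rinner_add_right: "rinner x (y + z) = rinner x y + rinner x z"
  by (simp add: rinner_def cinner_add_right)

lemma rinner_scaleR_left: "rinner (r *\<^sub>R x) y = r * rinner x y"
  by (simp add: rinner_def cinner_scaleR_left)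

lemma rinner_scaleR_right: "rinner x (r *\<^sub>R y) = r * rinner x y"
  by (simp add: rinner_def cinner_scaleR_right)

lemma rinner_minus_left: "rinner (- x) y = - rinner x y"
  using rinner_scaleR_left[of "-1"] by simp

lemma rinner_minus_right: "rinner x (- y) = - rinner x y"
  using rinner_scaleR_right[of _ "-1"] by simp

lemma rinner_diff_left: "rinner (x - y) z = rinner x z - rinner y z"
  using rinner_add_left[of x "-y" z] by (simp add: rinner_minus_left)

lemma rinner_diff_right: "rinner x (y - z) = rinner x y - rinner x z"
  using rinner_add_right[of x y "-z"] by (simp add: rinner_minus_right)

lemma rinner_zero_left [simp]: "rinner 0 x = 0"
  using rinner_scaleR_left[of 0] by simp

lemma rinner_zero_right [simp]: "rinner x 0 = 0"
  using rinner_scaleR_right[of _ 0] by simp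

lemmas rinner_simps = rinner_add_left rinner_add_right rinner_diff_left rinner_diff_right
  rinner_minus_left rinner_minus_right rinner_scaleR_left rinner_scaleR_right

lemma rinner_same: "rinner x x = (norm x)\<^sup>2"
proof -
  have "norm x = sqrt (rinner x x)"
    by (simp add: rinner_def norm_eq_sqrt_cinner)
  moreover from this have "rinner x x \<ge> 0"
    using norm_ge_zero[of x] real_sqrt_ge_0_iff by metis
  ultimately show ?thesis by simp
qed

lemma rinner_self_adjoint:
  assumes "self_adjoint A" shows "rinner (blinfun_apply A x) y = rinner x (blinfun_apply A y)"
  using assms by (simp add: self_adjoint_def rinner_def)

lemma nonneg_quadratic_discriminant:
  fixes a b c :: real
  assumes "\<And>t. 0 \<le> c - 2 * t * b + t\<^sup>2 * a" and "0 \<le> a"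
  shows "b\<^sup>2 \<le> c * a"
proof (cases "a = 0")
  case True
  have "b = 0"
  proof (rule ccontr)
    assume "b \<noteq> 0"
    then show False using assms(1)[of "(c + 1) / (2 * b)"] True by simp
  qed
  then show ?thesis using True by simp
next
  case False
  then show ?thesis
    using assms(1)[of "b / a"] assms(2) by (simp add: power2_eq_square field_simps)
qed

lemma pos_semidef_Cauchy_Schwarz:
  assumes "pos_semidef M"
  shows "(rinner (blinfun_apply M x) y)\<^sup>2
    \<le> rinner (blinfun_apply M x) x * rinner (blinfun_apply M y) y"
proof (rule nonneg_quadratic_discriminant)
  fix t :: real
  have sym: "rinner (blinfun_apply M y) x = rinner (blinfun_apply M x) y"
    using assms by (metis pos_semidef_def rinner_commute rinner_self_adjoint)
  have "0 \<le> rinner (blinfun_apply M (x - t *\<^sub>R y)) (x - t *\<^sub>R y)"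
    using assms by (simp add: pos_semidef_def rinner_def)
  also have "\<dots> = rinner (blinfun_apply M x) x - 2 * t * rinner (blinfun_apply M x) y
      + t\<^sup>2 * rinner (blinfun_apply M y) y"
    by (simp add: blinfun.bilinear_simps rinner_simps sym power2_eq_square algebra_simps)
  finally show "0 \<le> rinner (blinfun_apply M x) x - 2 * t * rinner (blinfun_apply M x) y
      + t\<^sup>2 * rinner (blinfun_apply M y) y" .
qed (use assms in \<open>simp add: pos_semidef_def rinner_def\<close>)

section \<open>Self-adjoint operators\<close>

lemma self_adjoint_id: "self_adjoint id_blinfun"
  by (simp add: self_adjoint_def complex_linear_op_def)

lemma scaleC_scaleR_commute: "c *\<^sub>C r *\<^sub>R x = r *\<^sub>R c *\<^sub>C x"
  by (metis scaleC_of_real scaleC_scaleC mult.commute)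

lemma self_adjoint_zero: "self_adjoint 0"
proof -
  have "c *\<^sub>C (0::'a) = 0" for c
    using scaleC_scaleR_commute[of c 0 "0::'a"] by simp
  moreover have "cinner 0 y = 0" "cinner y 0 = 0" for y :: 'a
    using cinner_scaleR_left[of 0 0 y] cinner_scaleR_right[of y 0 0] by simp_all
  ultimately show ?thesis by (simp add: self_adjoint_def complex_linear_op_def)
qed

lemma self_adjoint_add: "self_adjoint A \<Longrightarrow> self_adjoint B \<Longrightarrow> self_adjoint (A + B)"
  by (simp add: self_adjoint_def complex_linear_op_def blinfun.bilinear_simps cinner_add_left
      cinner_add_right scaleC_add_right)

lemma self_adjoint_scaleR: "self_adjoint A \<Longrightarrow> self_adjoint (r *\<^sub>R A)"
  by (simp add: self_adjoint_def complex_linear_op_def blinfun.bilinear_simps cinner_scaleR_left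
      cinner_scaleR_right scaleC_scaleR_commute)

lemma self_adjoint_diff: "self_adjoint A \<Longrightarrow> self_adjoint B \<Longrightarrow> self_adjoint (A - B)"
  using self_adjoint_add[of A "(-1) *\<^sub>R B"] self_adjoint_scaleR[of B "-1"] by simp

lemma self_adjoint_sum: "(\<And>i. i \<in> I \<Longrightarrow> self_adjoint (f i)) \<Longrightarrow> self_adjoint (\<Sum>i\<in>I. f i)"
  by (induction I rule: infinite_finite_induct) (auto simp: self_adjoint_zero self_adjoint_add)

lemma self_adjoint_conjugate:
  "self_adjoint A \<Longrightarrow> self_adjoint B \<Longrightarrow> self_adjoint (A o\<^sub>L B o\<^sub>L A)"
  by (simp add: self_adjoint_def complex_linear_op_def)

lemma self_adjoint_compose_commuting:
  assumes "self_adjoint A" "self_adjoint B" "A o\<^sub>L B = B o\<^sub>L A"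
  shows "self_adjoint (A o\<^sub>L B)"
proof -
  have "blinfun_apply A (blinfun_apply B x) = blinfun_apply B (blinfun_apply A x)" for x
    using assms(3) by (metis blinfun_apply_blinfun_compose)
  then show ?thesis using assms(1,2) by (simp add: self_adjoint_def complex_linear_op_def)
qed

lemma self_adjoint_inverse:
  assumes "self_adjoint A" "A o\<^sub>L B = id_blinfun" "B o\<^sub>L A = id_blinfun"
  shows "self_adjoint B"
proof -
  have AB: "blinfun_apply A (blinfun_apply B x) = x" for x
    using assms(2) by (metis blinfun_apply_blinfun_compose blinfun_apply_id_blinfun)
  have BA: "blinfun_apply B (blinfun_apply A x) = x" for x
    using assms(3) by (metis blinfun_apply_blinfun_compose blinfun_apply_id_blinfun)
  have "blinfun_apply B (c *\<^sub>C x) = c *\<^sub>C blinfun_apply B x" for c x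
    using assms(1) unfolding self_adjoint_def complex_linear_op_def by (metis AB BA)
  moreover have "cinner (blinfun_apply B x) y = cinner x (blinfun_apply B y)" for x y
    using assms(1) unfolding self_adjoint_def by (metis AB)
  ultimately show ?thesis by (simp add: self_adjoint_def complex_linear_op_def)
qed

lemma pos_semidef_id: "pos_semidef id_blinfun"
  by (simp add: pos_semidef_def self_adjoint_id rinner_same flip: rinner_def)

lemma rinner_Cauchy_Schwarz: "\<bar>rinner x y\<bar> \<le> norm x * norm y"
proof (rule power2_le_imp_le)
  show "\<bar>rinner x y\<bar>\<^sup>2 \<le> (norm x * norm y)\<^sup>2"
    using pos_semidef_Cauchy_Schwarz[OF pos_semidef_id, of x y]
    by (simp add: rinner_same power_mult_distrib)
qed simp

lemma norm_scaleC: "norm (c *\<^sub>C x) = cmod c * norm x"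
proof -
  have "cinner (c *\<^sub>C x) (c *\<^sub>C x) = of_real ((cmod c)\<^sup>2) * cinner x x"
    by (simp add: cinner_scaleC_left cinner_scaleC_right complex_norm_square mult_ac flip: of_real_power)
  then have "(norm (c *\<^sub>C x))\<^sup>2 = (cmod c * norm x)\<^sup>2"
    by (simp add: rinner_def power_mult_distrib flip: rinner_same)
  then show ?thesis by (simp add: power2_eq_iff_nonneg)
qed

lemma bounded_linear_scaleC: "bounded_linear ((*\<^sub>C) c :: 'a::complex_hilbert_space \<Rightarrow> 'a)"
  by (rule bounded_linear_intro[where K = "cmod c"])
    (simp_all add: scaleC_add_right scaleC_scaleR_commute norm_scaleC)

lemma Im_cinner: "Im (cinner x y) = rinner x (\<i> *\<^sub>C y)"
  by (simp add: rinner_def cinner_scaleC_right)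

lemma norm_cinner_le: "cmod (cinner x y) \<le> 2 * (norm x * norm y)"
  using cmod_le[of "cinner x y"] rinner_Cauchy_Schwarz[of x y] rinner_Cauchy_Schwarz[of x "\<i> *\<^sub>C y"]
  by (simp add: Im_cinner norm_scaleC flip: rinner_def)

lemma bounded_bilinear_cinner:
  "bounded_bilinear (cinner :: 'a::complex_hilbert_space \<Rightarrow> 'a \<Rightarrow> complex)"
proof (unfold_locales, goal_cases)
  case 5
  show ?case using norm_cinner_le by (metis mult.commute)
qed (simp_all add: cinner_add_left cinner_add_right cinner_scaleR_left cinner_scaleR_right
    scaleR_conv_of_real)

text \<open>Limits of self-adjoint operators are self-adjoint, so that fixed points found by iteration
  inside this set stay in it.\<close>

lemma closed_self_adjoint: "closed {A :: 'a::complex_hilbert_space oper. self_adjoint A}"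
proof -
  have ap: "continuous_on UNIV (\<lambda>A :: 'a oper. blinfun_apply A x)" for x
    by (intro continuous_intros)
  have "closed {A :: 'a oper. blinfun_apply A (c *\<^sub>C x) = c *\<^sub>C blinfun_apply A x}" for c x
    by (intro closed_Collect_eq ap bounded_linear.continuous_on[OF bounded_linear_scaleC])
  moreover have "closed {A :: 'a oper. cinner (blinfun_apply A x) y = cinner x (blinfun_apply A y)}"
    for x y
    by (intro closed_Collect_eq bounded_bilinear.continuous_on[OF bounded_bilinear_cinner] ap
        continuous_intros)
  ultimately show ?thesis
    unfolding self_adjoint_def complex_linear_op_def
    by (intro closed_Collect_conj closed_Collect_all)
qed

section \<open>Bounds for quadratic forms\<close>

lemma norm_quadratic_form_le: "\<bar>rinner (blinfun_apply A x) x\<bar> \<le> norm A * (norm x)\<^sup>2"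
proof -
  have "\<bar>rinner (blinfun_apply A x) x\<bar> \<le> norm (blinfun_apply A x) * norm x"
    by (rule rinner_Cauchy_Schwarz)
  also have "\<dots> \<le> (norm A * norm x) * norm x"
    by (intro mult_right_mono norm_blinfun) simp
  finally show ?thesis by (simp add: power2_eq_square algebra_simps)
qed

text \<open>This is the Cauchy--Schwarz inequality for the form \<open>\<langle>M x, y\<rangle>\<close> at \<open>y = M x\<close>:
  \<open>\<parallel>M x\<parallel>\<^sup>4 \<le> \<langle>M x, x\<rangle> \<langle>M y, y\<rangle> \<le> \<langle>M x, x\<rangle> b \<parallel>M x\<parallel>\<^sup>2\<close>.\<close>

lemma pos_semidef_norm_apply_le:
  assumes "pos_semidef M" and b: "\<And>x. rinner (blinfun_apply M x) x \<le> b * (norm x)\<^sup>2"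
  shows "(norm (blinfun_apply M x))\<^sup>2 \<le> b * rinner (blinfun_apply M x) x"
proof (cases "blinfun_apply M x = 0")
  case False
  let ?y = "blinfun_apply M x"
  have q: "0 \<le> rinner ?y x"
    using assms(1) by (simp add: pos_semidef_def rinner_def)
  have "((norm ?y)\<^sup>2)\<^sup>2 = (rinner ?y ?y)\<^sup>2"
    by (simp add: rinner_same)
  also have "\<dots> \<le> rinner ?y x * rinner (blinfun_apply M ?y) ?y"
    by (rule pos_semidef_Cauchy_Schwarz[OF assms(1)])
  also have "\<dots> \<le> rinner ?y x * (b * (norm ?y)\<^sup>2)"
    by (intro mult_left_mono b q)
  finally have "(norm ?y)\<^sup>2 * (norm ?y)\<^sup>2 \<le> (b * rinner ?y x) * (norm ?y)\<^sup>2"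
    by (simp add: power2_eq_square algebra_simps)
  moreover have "0 < (norm ?y)\<^sup>2" using False by simp
  ultimately show ?thesis using mult_right_le_imp_le by blast
qed simp

lemma pos_semidef_norm_le:
  assumes "pos_semidef M" and b: "\<And>x. rinner (blinfun_apply M x) x \<le> b * (norm x)\<^sup>2" and "0 \<le> b"
  shows "norm M \<le> b"
proof (rule norm_blinfun_bound[OF \<open>0 \<le> b\<close>])
  fix x
  have "(norm (blinfun_apply M x))\<^sup>2 \<le> b * rinner (blinfun_apply M x) x"
    by (rule pos_semidef_norm_apply_le[OF assms(1,2)])
  also have "\<dots> \<le> b * (b * (norm x)\<^sup>2)"
    by (intro mult_left_mono b \<open>0 \<le> b\<close>)
  also have "\<dots> = (b * norm x)\<^sup>2" by (simp add: power2_eq_square algebra_simps)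
  finally show "norm (blinfun_apply M x) \<le> b * norm x"
    by (rule power2_le_imp_le) (simp add: \<open>0 \<le> b\<close>)
qed

lemma pos_semidef_norm_mono:
  assumes "pos_semidef M" and "\<And>x. rinner (blinfun_apply M x) x \<le> rinner (blinfun_apply N x) x"
  shows "norm M \<le> norm N"
proof (rule pos_semidef_norm_le[OF assms(1)])
  show "rinner (blinfun_apply M x) x \<le> norm N * (norm x)\<^sup>2" for x
    using assms(2)[of x] norm_quadratic_form_le[of N x] by linarith
qed simp

section \<open>Coercive operators\<close>

text \<open>The lower bound is a parameter because the estimates depend on it.  The cases \<open>c = 0\<close>,
  \<open>c = 1\<close> and \<open>c > 0\<close> (for some \<open>c\<close>) are positivity, \<open>A \<ge> 1\<close> and positive definiteness.\<close>

definition coercive :: "real \<Rightarrow> 'a::complex_hilbert_space oper \<Rightarrow> bool"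
  where "coercive c A \<longleftrightarrow>
    self_adjoint A \<and> (\<forall>x. c * (norm x)\<^sup>2 \<le> rinner (blinfun_apply A x) x)"

lemma coercive_self_adjoint: "coercive c A \<Longrightarrow> self_adjoint A"
  by (simp add: coercive_def)

lemma coerciveD: "coercive c A \<Longrightarrow> c * (norm x)\<^sup>2 \<le> rinner (blinfun_apply A x) x"
  by (simp add: coercive_def)

lemma pos_semidef_iff_coercive: "pos_semidef A \<longleftrightarrow> coercive 0 A"
  by (simp add: pos_semidef_def coercive_def rinner_def)

lemma coercive_mono: "coercive c A \<Longrightarrow> d \<le> c \<Longrightarrow> coercive d A"
  unfolding coercive_def by (meson mult_right_mono order_trans zero_le_power2)

lemma coercive_nonneg_pos_semidef: "coercive c A \<Longrightarrow> 0 \<le> c \<Longrightarrow> pos_semidef A"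
  by (simp add: pos_semidef_iff_coercive coercive_mono)

lemma id_loewner_le_iff: "id_blinfun \<le>\<^sub>L Z \<longleftrightarrow> coercive 1 Z"
proof
  assume "id_blinfun \<le>\<^sub>L Z"
  then have "self_adjoint (Z - id_blinfun)"
    and *: "0 \<le> rinner (blinfun_apply (Z - id_blinfun) x) x" for x
    by (auto simp: loewner_le_def pos_semidef_iff_coercive coercive_def)
  then have "self_adjoint Z"
    using self_adjoint_add[OF _ self_adjoint_id, of "Z - id_blinfun"] by simp
  then show "coercive 1 Z"
    using * by (simp add: coercive_def blinfun.bilinear_simps rinner_simps rinner_same)
next
  assume "coercive 1 Z"
  then show "id_blinfun \<le>\<^sub>L Z"
    by (simp add: loewner_le_def pos_semidef_iff_coercive coercive_def blinfun.bilinear_simps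
        rinner_simps rinner_same self_adjoint_diff self_adjoint_id)
qed

lemma blinfun_compose_assoc: "(A o\<^sub>L B) o\<^sub>L C = A o\<^sub>L (B o\<^sub>L C)"
  by (rule blinfun_eqI) simp

lemma id_blinfun_compose [simp]: "id_blinfun o\<^sub>L A = A" "A o\<^sub>L id_blinfun = A"
  by (rule blinfun_eqI, simp)+

lemmas compose_simps =
  bounded_bilinear.add_left[OF bounded_bilinear_blinfun_compose]
  bounded_bilinear.add_right[OF bounded_bilinear_blinfun_compose]
  bounded_bilinear.diff_left[OF bounded_bilinear_blinfun_compose]
  bounded_bilinear.diff_right[OF bounded_bilinear_blinfun_compose]
  bounded_bilinear.scaleR_left[OF bounded_bilinear_blinfun_compose]
  bounded_bilinear.scaleR_right[OF bounded_bilinear_blinfun_compose]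
  bounded_bilinear.minus_left[OF bounded_bilinear_blinfun_compose]
  bounded_bilinear.minus_right[OF bounded_bilinear_blinfun_compose]

text \<open>Composing an equation on the right lets the simplifier cancel inverses inside right-nested
  products.\<close>

lemma compose_eq_left: "A o\<^sub>L B = C \<Longrightarrow> A o\<^sub>L (B o\<^sub>L X) = C o\<^sub>L X"
  by (metis blinfun_compose_assoc)

text \<open>The number \<open>b\<close> only has to exceed the norm of \<open>A\<close>: then \<open>0 \<le> 1 - A / b \<le> 1 - c / b\<close>.\<close>

lemma coercive_scaled_near_id:
  assumes "coercive c A" and "0 < c"
  obtains b q where "0 < b" "0 \<le> q" "q < 1" "norm (id_blinfun - (1 / b) *\<^sub>R A) \<le> q"
proof
  define b where "b = norm A + c"
  define q where "q = 1 - c / b"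
  define E where "E = id_blinfun - (1 / b) *\<^sub>R A"
  have b: "b > 0" "norm A \<le> b" "c \<le> b"
    using \<open>0 < c\<close> by (auto simp: b_def add_nonneg_pos)
  have q: "0 \<le> q" "q < 1"
    using b \<open>0 < c\<close> by (auto simp: q_def)
  have E_form: "rinner (blinfun_apply E x) x = (norm x)\<^sup>2 - rinner (blinfun_apply A x) x / b" for x
    by (simp add: E_def blinfun.bilinear_simps rinner_simps rinner_same)
  have "norm E \<le> q"
  proof (rule pos_semidef_norm_le[OF _ _ q(1)])
    have "self_adjoint E"
      unfolding E_def using coercive_self_adjoint[OF assms(1)]
      by (intro self_adjoint_diff self_adjoint_id self_adjoint_scaleR)
    moreover have "0 \<le> rinner (blinfun_apply E x) x" for x
    proof -
      have "rinner (blinfun_apply A x) x \<le> norm A * (norm x)\<^sup>2"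
        using norm_quadratic_form_le[of A x] by linarith
      also have "\<dots> \<le> b * (norm x)\<^sup>2"
        using b by (intro mult_right_mono) auto
      finally show ?thesis using b by (simp add: E_form field_simps)
    qed
    ultimately show "pos_semidef E" by (simp add: pos_semidef_iff_coercive coercive_def)
    show "rinner (blinfun_apply E x) x \<le> q * (norm x)\<^sup>2" for x
      using coerciveD[OF assms(1), of x] b(1) by (simp add: E_form q_def field_simps)
  qed
  show "0 < b" "0 \<le> q" "q < 1" "norm (id_blinfun - (1 / b) *\<^sub>R A) \<le> q"
    using b q \<open>norm E \<le> q\<close> by (simp_all add: E_def)
qed

text \<open>With \<open>E = 1 - A / b\<close> of norm less than one, \<open>Y \<mapsto> 1 / b + E Y\<close> and \<open>Y \<mapsto> 1 / b + Y E\<close> are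
  contractions; their fixed points are a right and a left inverse of \<open>A\<close>.\<close>

lemma coercive_op_invertible:
  assumes "coercive c A" and "0 < c"
  shows "op_invertible A"
proof -
  obtain b q where b: "0 < b" and q: "0 \<le> q" "q < 1"
    and Eq: "norm (id_blinfun - (1 / b) *\<^sub>R A) \<le> q"
    using coercive_scaled_near_id[OF assms] by blast
  define E where "E = id_blinfun - (1 / b) *\<^sub>R A"
  have "norm E \<le> q" using Eq by (simp add: E_def)
  have contr: "norm (E o\<^sub>L Y) \<le> q * norm Y" "norm (Y o\<^sub>L E) \<le> q * norm Y" for Y
    using norm_blinfun_compose[of E Y] norm_blinfun_compose[of Y E] \<open>norm E \<le> q\<close>
      mult_right_mono[OF \<open>norm E \<le> q\<close>, of "norm Y"] by (auto simp: mult.commute)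
  have "\<exists>!Y. (1 / b) *\<^sub>R id_blinfun + (E o\<^sub>L Y) = Y"
    using contr(1) by (intro banach_fix_type[OF q])
      (simp add: dist_norm flip: compose_simps)
  then obtain Y where Y: "Y = (1 / b) *\<^sub>R id_blinfun + (E o\<^sub>L Y)" by metis
  have "\<exists>!Y. (1 / b) *\<^sub>R id_blinfun + (Y o\<^sub>L E) = Y"
    using contr(2) by (intro banach_fix_type[OF q])
      (simp add: dist_norm flip: compose_simps)
  then obtain Y' where Y': "Y' = (1 / b) *\<^sub>R id_blinfun + (Y' o\<^sub>L E)" by metis
  have "(1 / b) *\<^sub>R (A o\<^sub>L Y) = Y - (E o\<^sub>L Y)"
    by (simp add: E_def compose_simps)
  then have "(1 / b) *\<^sub>R (A o\<^sub>L Y) = (1 / b) *\<^sub>R id_blinfun"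
    using Y by (metis add_diff_cancel_right')
  then have AY: "A o\<^sub>L Y = id_blinfun"
    using b by (metis scaleR_left_imp_eq zero_less_divide_1_iff less_numeral_extra(3))
  have "(1 / b) *\<^sub>R (Y' o\<^sub>L A) = Y' - (Y' o\<^sub>L E)"
    by (simp add: E_def compose_simps)
  then have "(1 / b) *\<^sub>R (Y' o\<^sub>L A) = (1 / b) *\<^sub>R id_blinfun"
    using Y' by (metis add_diff_cancel_right')
  then have YA: "Y' o\<^sub>L A = id_blinfun"
    using b by (metis scaleR_left_imp_eq zero_less_divide_1_iff less_numeral_extra(3))
  have "Y' = Y' o\<^sub>L (A o\<^sub>L Y)" by (simp add: AY)
  also have "\<dots> = Y" by (simp add: YA flip: blinfun_compose_assoc)
  finally show ?thesis using AY YA unfolding op_invertible_def by blast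
qed

lemma op_inv_eqI:
  assumes "A o\<^sub>L B = id_blinfun" "B o\<^sub>L A = id_blinfun"
  shows "op_inv A = B"
  unfolding op_inv_def
proof (rule the_equality)
  fix C assume "A o\<^sub>L C = id_blinfun \<and> C o\<^sub>L A = id_blinfun"
  then show "C = B"
    using assms by (metis blinfun_compose_assoc id_blinfun_compose)
qed (use assms in blast)

lemma op_invertible_op_inv:
  assumes "op_invertible A"
  shows "A o\<^sub>L op_inv A = id_blinfun" "op_inv A o\<^sub>L A = id_blinfun"
  using assms op_inv_eqI unfolding op_invertible_def by metis+

lemma PD_op_inv:
  assumes "A \<in> PD"
  shows "A o\<^sub>L op_inv A = id_blinfun" "op_inv A o\<^sub>L A = id_blinfun"
  using assms by (auto simp: PD_def op_invertible_op_inv)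

text \<open>If \<open>A \<ge> 0\<close> has the inverse \<open>B\<close> then \<open>\<parallel>x\<parallel> \<le> \<parallel>B\<parallel> \<parallel>A x\<parallel>\<close>, while
  \<open>\<parallel>A x\<parallel>\<^sup>2 \<le> \<parallel>A\<parallel> \<langle>A x, x\<rangle>\<close>; together these bound \<open>\<langle>A x, x\<rangle>\<close> from below.\<close>

lemma PD_iff_coercive: "A \<in> PD \<longleftrightarrow> (\<exists>c>0. coercive c A)"
proof
  assume "\<exists>c>0. coercive c A"
  then show "A \<in> PD"
    using coercive_op_invertible coercive_nonneg_pos_semidef unfolding PD_def
    by (blast intro: less_imp_le)
next
  assume A: "A \<in> PD"
  let ?B = "op_inv A"
  define m where "m = (norm A + 1) * (norm ?B + 1)\<^sup>2"
  have psd: "pos_semidef A" using A by (simp add: PD_def)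
  have m: "m > 0" unfolding m_def by (intro mult_pos_pos zero_less_power add_nonneg_pos) auto
  have "(1 / m) * (norm x)\<^sup>2 \<le> rinner (blinfun_apply A x) x" for x
  proof -
    have q: "0 \<le> rinner (blinfun_apply A x) x"
      using psd by (simp add: pos_semidef_def rinner_def)
    have "x = blinfun_apply ?B (blinfun_apply A x)"
      using PD_op_inv(2)[OF A] by (metis blinfun_apply_blinfun_compose blinfun_apply_id_blinfun)
    then have "norm x \<le> norm ?B * norm (blinfun_apply A x)"
      by (metis norm_blinfun)
    also have "\<dots> \<le> (norm ?B + 1) * norm (blinfun_apply A x)"
      by (intro mult_right_mono) auto
    finally have "(norm x)\<^sup>2 \<le> (norm ?B + 1)\<^sup>2 * (norm (blinfun_apply A x))\<^sup>2"
      by (metis norm_ge_zero power_mono power_mult_distrib)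
    also have "\<dots> \<le> (norm ?B + 1)\<^sup>2 * (norm A * rinner (blinfun_apply A x) x)"
      using norm_quadratic_form_le[of A] by (intro mult_left_mono pos_semidef_norm_apply_le psd)
        (auto intro: order_trans[OF abs_ge_self])
    also have "\<dots> \<le> (norm ?B + 1)\<^sup>2 * ((norm A + 1) * rinner (blinfun_apply A x) x)"
      using q by (intro mult_left_mono mult_right_mono) auto
    finally have "(norm x)\<^sup>2 \<le> m * rinner (blinfun_apply A x) x"
      by (simp add: m_def algebra_simps)
    then show ?thesis using m by (simp add: field_simps)
  qed
  then have "coercive (1 / m) A"
    using psd by (simp add: coercive_def pos_semidef_def)
  then show "\<exists>c>0. coercive c A" using m by (intro exI[of _ "1 / m"]) simp
qed

lemma coercive_PD: "coercive c A \<Longrightarrow> 0 < c \<Longrightarrow> A \<in> PD"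
  using PD_iff_coercive by blast

lemma PD_self_adjoint: "A \<in> PD \<Longrightarrow> self_adjoint A"
  by (simp add: PD_def pos_semidef_def)

lemma PD_pos_semidef: "A \<in> PD \<Longrightarrow> pos_semidef A"
  by (simp add: PD_def)

lemma coercive_norm_apply_ge:
  assumes "coercive c A"
  shows "c * norm x \<le> norm (blinfun_apply A x)"
proof (cases "x = 0")
  case False
  have "c * (norm x)\<^sup>2 \<le> norm (blinfun_apply A x) * norm x"
    using coerciveD[OF assms, of x] rinner_Cauchy_Schwarz[of "blinfun_apply A x" x] by linarith
  then show ?thesis using False by (simp add: power2_eq_square)
qed simp

lemma norm_op_inv_le:
  assumes "coercive c A" "0 < c"
  shows "norm (op_inv A) \<le> 1 / c"
proof (rule norm_blinfun_bound)
  fix x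
  have "c * norm (blinfun_apply (op_inv A) x) \<le> norm (blinfun_apply A (blinfun_apply (op_inv A) x))"
    by (rule coercive_norm_apply_ge[OF assms(1)])
  also have "blinfun_apply A (blinfun_apply (op_inv A) x) = x"
    using PD_op_inv(1)[OF coercive_PD[OF assms]]
    by (metis blinfun_apply_blinfun_compose blinfun_apply_id_blinfun)
  finally show "norm (blinfun_apply (op_inv A) x) \<le> 1 / c * norm x"
    using \<open>0 < c\<close> by (simp add: field_simps)
qed (use assms in simp)

text \<open>With \<open>y = A\<^sup>-\<^sup>1 x\<close> the lower bound becomes \<open>\<parallel>A y\<parallel>\<^sup>2 \<le> b \<langle>A y, y\<rangle>\<close>.\<close>

lemma coercive_op_inv:
  assumes "A \<in> PD" "norm A \<le> b" "0 < b"
  shows "coercive (1 / b) (op_inv A)"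
  unfolding coercive_def
proof (intro conjI allI)
  show "self_adjoint (op_inv A)"
    using self_adjoint_inverse PD_self_adjoint PD_op_inv assms(1) by blast
  fix x
  define y where "y = blinfun_apply (op_inv A) x"
  have Ay: "blinfun_apply A y = x"
    using PD_op_inv(1)[OF assms(1)] unfolding y_def
    by (metis blinfun_apply_blinfun_compose blinfun_apply_id_blinfun)
  have "(norm (blinfun_apply A y))\<^sup>2 \<le> b * rinner (blinfun_apply A y) y"
  proof (rule pos_semidef_norm_apply_le[OF PD_pos_semidef[OF assms(1)]])
    fix z
    have "rinner (blinfun_apply A z) z \<le> norm A * (norm z)\<^sup>2"
      using norm_quadratic_form_le[of A z] by linarith
    then show "rinner (blinfun_apply A z) z \<le> b * (norm z)\<^sup>2"
      using mult_right_mono[OF assms(2), of "(norm z)\<^sup>2"] by simp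
  qed
  then show "1 / b * (norm x)\<^sup>2 \<le> rinner (blinfun_apply (op_inv A) x) x"
    using \<open>0 < b\<close> by (simp add: Ay rinner_commute field_simps flip: y_def)
qed

lemma op_inv_PD:
  assumes "A \<in> PD" shows "op_inv A \<in> PD"
proof (rule coercive_PD)
  show "coercive (1 / (norm A + 1)) (op_inv A)"
    by (rule coercive_op_inv[OF assms]) (auto simp: add_nonneg_pos)
qed (simp add: add_nonneg_pos)

lemma op_inv_op_inv: "A \<in> PD \<Longrightarrow> op_inv (op_inv A) = A"
  by (intro op_inv_eqI PD_op_inv)

lemma PD_conjugate:
  assumes "A \<in> PD" "B \<in> PD"
  shows "A o\<^sub>L B o\<^sub>L A \<in> PD"
proof -
  obtain a b where ab: "a > 0" "coercive a A" "b > 0" "coercive b B"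
    using assms PD_iff_coercive by blast
  have "coercive (b * a\<^sup>2) (A o\<^sub>L B o\<^sub>L A)"
    unfolding coercive_def
  proof (intro conjI allI)
    show "self_adjoint (A o\<^sub>L B o\<^sub>L A)"
      using assms by (intro self_adjoint_conjugate PD_self_adjoint)
    fix x
    have "a * norm x \<le> norm (blinfun_apply A x)"
      using coercive_norm_apply_ge ab by blast
    then have "(a * norm x)\<^sup>2 \<le> (norm (blinfun_apply A x))\<^sup>2"
      using ab by (intro power_mono) auto
    then have "b * a\<^sup>2 * (norm x)\<^sup>2 \<le> b * (norm (blinfun_apply A x))\<^sup>2"
      using ab by (simp add: power_mult_distrib)
    also have "\<dots> \<le> rinner (blinfun_apply B (blinfun_apply A x)) (blinfun_apply A x)"
      by (rule coerciveD[OF ab(4)])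
    finally show "b * a\<^sup>2 * (norm x)\<^sup>2 \<le> rinner (blinfun_apply (A o\<^sub>L B o\<^sub>L A) x) x"
      using rinner_self_adjoint[OF PD_self_adjoint[OF assms(1)]] by simp
  qed
  then show ?thesis using ab by (intro coercive_PD[of "b * a\<^sup>2"]) auto
qed

section \<open>A Lyapunov inequality\<close>

text \<open>Where \<open>T\<close> acts as \<open>t S\<close>, the form of \<open>S H T + T H S\<close> is \<open>2 t \<langle>H S x, S x\<rangle> \<ge> 2 t c \<parallel>x\<parallel>\<^sup>2\<close>, which
  leaves room only for \<open>t \<le> r / (2 c)\<close>.  To make this precise without diagonalising, let \<open>t\<close> be the
  least non-negative number with \<open>T \<le> t S\<close> and put \<open>M = t S - T \<ge> 0\<close>.  If \<open>t\<close> were larger than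
  \<open>r / (2 c)\<close>, then \<open>\<parallel>M x\<parallel>\<close> would be at least a fixed multiple of \<open>\<parallel>x\<parallel>\<close>.  As
  \<open>\<parallel>M x\<parallel>\<^sup>2 \<le> \<parallel>M\<parallel> \<langle>M x, x\<rangle>\<close>, this gives \<open>M \<ge> d S\<close> for some \<open>d > 0\<close>, so \<open>T \<le> (t - d) S\<close>,
  and \<open>t\<close> would not be least.\<close>

lemma Lyapunov_bound:
  assumes S: "coercive 1 S" and H: "coercive c H" and "0 < c" and T: "self_adjoint T"
    and R: "norm ((S o\<^sub>L H o\<^sub>L T) + (T o\<^sub>L H o\<^sub>L S)) \<le> r"
  shows "rinner (blinfun_apply T x) x \<le> r / (2 * c) * rinner (blinfun_apply S x) x"
proof -
  define Q where "Q = {t. 0 \<le> t \<and>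
    (\<forall>x. rinner (blinfun_apply T x) x \<le> t * rinner (blinfun_apply S x) x)}"
  have S1: "(norm x)\<^sup>2 \<le> rinner (blinfun_apply S x) x" for x
    using coerciveD[OF S, of x] by simp
  have S0: "0 \<le> rinner (blinfun_apply S x) x" for x
    using S1[of x] zero_le_power2 order_trans by blast
  have "closed Q"
    unfolding Q_def by (intro closed_Collect_conj closed_Collect_all closed_Collect_le
        continuous_intros)
  moreover have "norm T \<in> Q"
  proof -
    have "rinner (blinfun_apply T x) x \<le> norm T * rinner (blinfun_apply S x) x" for x
    proof -
      have "rinner (blinfun_apply T x) x \<le> norm T * (norm x)\<^sup>2"
        using norm_quadratic_form_le[of T x] by linarith
      also have "\<dots> \<le> norm T * rinner (blinfun_apply S x) x"
        by (intro mult_left_mono S1) simp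
      finally show ?thesis .
    qed
    then show ?thesis by (simp add: Q_def)
  qed
  moreover have "bdd_below Q" by (auto simp: Q_def intro!: bdd_belowI[of _ 0])
  ultimately have InfQ: "Inf Q \<in> Q" by (intro closed_contains_Inf) auto
  define t where "t = Inf Q"
  have t: "0 \<le> t" "\<And>x. rinner (blinfun_apply T x) x \<le> t * rinner (blinfun_apply S x) x"
    using InfQ by (auto simp: Q_def t_def)
  have r: "0 \<le> r" using R norm_ge_zero order_trans by blast
  have "t \<le> r / (2 * c)"
  proof (rule ccontr)
    assume "\<not> t \<le> r / (2 * c)"
    then have gap: "0 < 2 * t * c - r" using \<open>0 < c\<close> by (simp add: field_simps)
    define M where "M = t *\<^sub>R S - T"
    \<comment> \<open>The summands \<open>1\<close> here and in \<open>d\<close> keep denominators positive.\<close>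
    define k where "k = 2 * norm H * norm S + 1"
    have k: "k > 0" by (auto simp: k_def intro!: add_nonneg_pos mult_nonneg_nonneg)
    have M: "pos_semidef M"
      using t(2) coercive_self_adjoint[OF S] T
      by (simp add: M_def pos_semidef_iff_coercive coercive_def self_adjoint_diff
          self_adjoint_scaleR blinfun.bilinear_simps rinner_simps)
    have lower: "(2 * t * c - r) / k * norm x \<le> norm (blinfun_apply M x)" for x
    proof (cases "x = 0")
      case False
      let ?S = "blinfun_apply S x" and ?T = "blinfun_apply T x" and ?M = "blinfun_apply M x"
      have "rinner (blinfun_apply ((S o\<^sub>L H o\<^sub>L T) + (T o\<^sub>L H o\<^sub>L S)) x) x
          = 2 * rinner (blinfun_apply H ?S) ?T"
      proof -
        have "rinner (blinfun_apply S (blinfun_apply H ?T)) x = rinner ?T (blinfun_apply H ?S)"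
          using S H by (simp add: rinner_self_adjoint coercive_self_adjoint)
        moreover have "rinner (blinfun_apply T (blinfun_apply H ?S)) x
            = rinner (blinfun_apply H ?S) ?T"
          by (rule rinner_self_adjoint[OF T])
        ultimately show ?thesis
          by (simp add: blinfun.bilinear_simps rinner_simps rinner_commute)
      qed
      moreover have "?T = t *\<^sub>R ?S - ?M"
        by (simp add: M_def blinfun.bilinear_simps)
      ultimately have "2 * t * rinner (blinfun_apply H ?S) ?S - 2 * rinner (blinfun_apply H ?S) ?M
          = rinner (blinfun_apply ((S o\<^sub>L H o\<^sub>L T) + (T o\<^sub>L H o\<^sub>L S)) x) x"
        by (simp add: rinner_simps algebra_simps)
      also have "\<dots> \<le> r * (norm x)\<^sup>2"
        using norm_quadratic_form_le[of "(S o\<^sub>L H o\<^sub>L T) + (T o\<^sub>L H o\<^sub>L S)" x]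
          mult_right_mono[OF R, of "(norm x)\<^sup>2"] by simp
      finally have "2 * t * rinner (blinfun_apply H ?S) ?S
          \<le> r * (norm x)\<^sup>2 + 2 * rinner (blinfun_apply H ?S) ?M" by simp
      moreover have "2 * t * (c * (norm x)\<^sup>2) \<le> 2 * t * rinner (blinfun_apply H ?S) ?S"
      proof (rule mult_left_mono)
        have "norm x \<le> norm ?S" using coercive_norm_apply_ge[OF S, of x] by simp
        then have "c * (norm x)\<^sup>2 \<le> c * (norm ?S)\<^sup>2"
          using \<open>0 < c\<close> by (intro mult_left_mono power_mono) auto
        also have "\<dots> \<le> rinner (blinfun_apply H ?S) ?S" by (rule coerciveD[OF H])
        finally show "c * (norm x)\<^sup>2 \<le> rinner (blinfun_apply H ?S) ?S" .
      qed (use t in simp)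
      moreover have "2 * rinner (blinfun_apply H ?S) ?M \<le> k * norm x * norm ?M"
      proof -
        have "rinner (blinfun_apply H ?S) ?M \<le> norm (blinfun_apply H ?S) * norm ?M"
          using rinner_Cauchy_Schwarz[of "blinfun_apply H ?S" ?M] by linarith
        also have "\<dots> \<le> (norm H * (norm S * norm x)) * norm ?M"
          by (intro mult_right_mono order_trans[OF norm_blinfun] mult_left_mono norm_blinfun) auto
        finally have "2 * rinner (blinfun_apply H ?S) ?M \<le> (k - 1) * norm x * norm ?M"
          by (simp add: k_def algebra_simps)
        also have "\<dots> \<le> k * norm x * norm ?M"
          by (intro mult_right_mono) auto
        finally show ?thesis .
      qed
      ultimately have "(2 * t * c - r) * (norm x)\<^sup>2 \<le> k * norm x * norm ?M"
        by (simp add: algebra_simps)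
      then have "(2 * t * c - r) * norm x \<le> k * norm ?M"
        using False by (simp add: power2_eq_square)
      then show ?thesis using k by (simp add: field_simps)
    qed simp
    define d where "d = ((2 * t * c - r) / k)\<^sup>2 / ((norm M + 1) * (norm S + 1))"
    have pos: "0 < (norm M + 1) * (norm S + 1)"
      by (intro mult_pos_pos add_nonneg_pos) auto
    have d: "d > 0"
      unfolding d_def using gap k pos by (intro divide_pos_pos zero_less_power) auto
    have step: "d * rinner (blinfun_apply S x) x \<le> rinner (blinfun_apply M x) x" for x
    proof -
      have q: "0 \<le> rinner (blinfun_apply M x) x"
        using M by (simp add: pos_semidef_def rinner_def)
      have "((2 * t * c - r) / k)\<^sup>2 * rinner (blinfun_apply S x) x
          \<le> ((2 * t * c - r) / k)\<^sup>2 * ((norm S + 1) * (norm x)\<^sup>2)"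
      proof (rule mult_left_mono)
        have "rinner (blinfun_apply S x) x \<le> norm S * (norm x)\<^sup>2"
          using norm_quadratic_form_le[of S x] by linarith
        also have "\<dots> \<le> (norm S + 1) * (norm x)\<^sup>2" by (intro mult_right_mono) auto
        finally show "rinner (blinfun_apply S x) x \<le> (norm S + 1) * (norm x)\<^sup>2" .
      qed simp
      also have "\<dots> = (norm S + 1) * ((2 * t * c - r) / k * norm x)\<^sup>2"
        by (simp only: power_mult_distrib mult.left_commute)
      also have "\<dots> \<le> (norm S + 1) * (norm (blinfun_apply M x))\<^sup>2"
        using lower[of x] gap k by (intro mult_left_mono power_mono) auto
      also have "\<dots> \<le> (norm S + 1) * (norm M * rinner (blinfun_apply M x) x)"
        using norm_quadratic_form_le[of M] by (intro mult_left_mono pos_semidef_norm_apply_le M)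
          (auto intro: order_trans[OF abs_ge_self])
      also have "\<dots> \<le> (norm S + 1) * ((norm M + 1) * rinner (blinfun_apply M x) x)"
        using q by (intro mult_left_mono mult_right_mono) auto
      finally show ?thesis
        using pos by (simp add: d_def pos_divide_le_eq mult_ac)
    qed
    have TS: "rinner (blinfun_apply T x) x \<le> (t - d) * rinner (blinfun_apply S x) x" for x
      using step[of x] by (simp add: M_def blinfun.bilinear_simps rinner_simps algebra_simps)
    define t' where "t' = max 0 (t - d)"
    have "t' \<in> Q"
    proof -
      have "rinner (blinfun_apply T x) x \<le> t' * rinner (blinfun_apply S x) x" for x
        using TS[of x] mult_right_mono[OF _ S0[of x], of "t - d" t'] by (simp add: t'_def)
      then show ?thesis by (simp add: Q_def t'_def)
    qed
    then have "t \<le> t'" unfolding t_def using \<open>bdd_below Q\<close> by (intro cInf_lower)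
    moreover have "t' < t"
    proof -
      have "0 < 2 * t * c" using gap r by linarith
      then have "0 < t" using \<open>0 < c\<close> by (simp add: zero_less_mult_iff)
      then show ?thesis using d by (simp add: t'_def)
    qed
    ultimately show False by simp
  qed
  then show ?thesis
    using t(2)[of x] mult_right_mono[OF _ S0[of x], of t "r / (2 * c)"] by linarith
qed

section \<open>Square roots and the near-order\<close>

lemma self_adjoint_zero_form:
  assumes "self_adjoint T" "\<And>x. rinner (blinfun_apply T x) x = 0"
  shows "T = 0"
proof -
  have "norm T \<le> 0"
    using assms by (intro pos_semidef_norm_le) (auto simp: pos_semidef_iff_coercive coercive_def)
  then show ?thesis by simp
qed

text \<open>If \<open>B\<^sup>2 = C\<^sup>2\<close> then \<open>T = B - C\<close> satisfies \<open>S T + T S = 0\<close> with \<open>S = B + C\<close>.  After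
  scaling \<open>S\<close> to \<open>S \<ge> 1\<close>, the Lyapunov bound with \<open>r = 0\<close> applies to both \<open>T\<close> and \<open>- T\<close>.\<close>

lemma PD_square_inject:
  assumes B: "B \<in> PD" and C: "C \<in> PD" and sq: "B o\<^sub>L B = C o\<^sub>L C"
  shows "B = C"
proof -
  obtain b where b: "0 < b" "coercive b B" using B PD_iff_coercive by blast
  have C0: "0 \<le> rinner (blinfun_apply C x) x" for x
    using PD_pos_semidef[OF C] by (simp add: pos_semidef_def rinner_def)
  define S where "S = (1 / b) *\<^sub>R (B + C)"
  have S: "coercive 1 S"
    using b(1) coerciveD[OF b(2)] C0 PD_self_adjoint[OF B] PD_self_adjoint[OF C]
    by (auto simp: S_def coercive_def self_adjoint_scaleR self_adjoint_add blinfun.bilinear_simps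
        rinner_simps field_simps add_increasing2)
  have le: "rinner (blinfun_apply T x) x \<le> 0"
    if "self_adjoint T" "(S o\<^sub>L T) + (T o\<^sub>L S) = 0" for T x
    using Lyapunov_bound[OF S, of 1 id_blinfun T 0 x] that
    by (simp add: coercive_def self_adjoint_id rinner_same)
  have "self_adjoint (B - C)" "self_adjoint (C - B)"
    using B C by (simp_all add: self_adjoint_diff PD_self_adjoint)
  moreover have "(S o\<^sub>L (B - C)) + ((B - C) o\<^sub>L S) = 0" "(S o\<^sub>L (C - B)) + ((C - B) o\<^sub>L S) = 0"
    by (simp_all add: S_def compose_simps sq flip: scaleR_right_distrib scaleR_right_diff_distrib)
  ultimately have "rinner (blinfun_apply (B - C) x) x = 0" for x
    using le[of "B - C" x] le[of "C - B" x] by (simp add: blinfun.bilinear_simps rinner_simps)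
  then have "B - C = 0"
    using \<open>self_adjoint (B - C)\<close> by (intro self_adjoint_zero_form)
  then show ?thesis by simp
qed

lemma norm_compose_mono: "norm A \<le> a \<Longrightarrow> norm B \<le> b \<Longrightarrow> norm (A o\<^sub>L B) \<le> a * b"
  by (meson norm_blinfun_compose mult_mono norm_ge_zero order_trans)

text \<open>After scaling, \<open>A = 1 - E\<close> with \<open>\<parallel>E\<parallel> \<le> q < 1\<close>, and a root has the form \<open>1 - Y\<close> where
  \<open>Y = (E + Y\<^sup>2) / 2\<close>.  This map is a contraction of the self-adjoint ball whose radius \<open>p < 1\<close> solves
  \<open>p = (q + p\<^sup>2) / 2\<close>.\<close>

lemma PD_square_root_exists:
  assumes "A \<in> PD"
  obtains B where "B \<in> PD" "B o\<^sub>L B = A"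
proof -
  obtain c where c: "coercive c A" "0 < c" using assms PD_iff_coercive by blast
  obtain b q where b: "0 < b" and q: "0 \<le> q" "q < 1"
    and Eq: "norm (id_blinfun - (1 / b) *\<^sub>R A) \<le> q"
    using coercive_scaled_near_id[OF c] by blast
  define E where "E = id_blinfun - (1 / b) *\<^sub>R A"
  define p where "p = 1 - sqrt (1 - q)"
  define K where "K = {Y :: 'a oper. self_adjoint Y \<and> norm Y \<le> p}"
  define f where "f = (\<lambda>Y. (1 / 2) *\<^sub>R (E + (Y o\<^sub>L Y)))"
  have p: "0 \<le> p" "p < 1" using q by (auto simp: p_def)
  have p_eq: "q + p * p = 2 * p"
  proof -
    have "(1 - p) * (1 - p) = 1 - q" using q by (simp add: p_def)
    then show ?thesis by (simp add: algebra_simps)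
  qed
  have "closed K"
    unfolding K_def by (intro closed_Collect_conj closed_self_adjoint closed_Collect_le
        continuous_intros)
  then have "complete K" by (simp add: complete_eq_closed)
  moreover have "0 \<in> K" using p by (simp add: K_def self_adjoint_zero)
  moreover have "f Y \<in> K" if "Y \<in> K" for Y
  proof -
    have Y: "self_adjoint Y" "norm Y \<le> p" using that by (auto simp: K_def)
    have "self_adjoint (f Y)"
      using Y(1) coercive_self_adjoint[OF c(1)]
      by (simp add: f_def E_def self_adjoint_scaleR self_adjoint_add self_adjoint_diff
          self_adjoint_id self_adjoint_compose_commuting)
    moreover have "norm (f Y) \<le> (1 / 2) * (q + p * p)"
      unfolding f_def norm_scaleR
      using norm_triangle_mono[OF Eq norm_compose_mono[OF Y(2) Y(2)]] by (simp add: E_def)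
    ultimately show ?thesis by (simp add: K_def p_eq)
  qed
  moreover have "dist (f Y) (f Z) \<le> p * dist Y Z" if "Y \<in> K" "Z \<in> K" for Y Z
  proof -
    have "f Y - f Z = (1 / 2) *\<^sub>R ((Y o\<^sub>L (Y - Z)) + ((Y - Z) o\<^sub>L Z))"
      by (simp add: f_def compose_simps scaleR_right_distrib scaleR_right_diff_distrib)
    moreover have "norm ((Y o\<^sub>L (Y - Z)) + ((Y - Z) o\<^sub>L Z)) \<le> p * norm (Y - Z) + norm (Y - Z) * p"
      using that by (intro norm_triangle_mono norm_compose_mono) (auto simp: K_def)
    ultimately show ?thesis by (simp add: dist_norm)
  qed
  ultimately have "\<exists>!Y\<in>K. f Y = Y"
    using p by (intro Banach_fix[of K p f]) auto
  then obtain Y where Y: "Y \<in> K" "f Y = Y" by blast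
  define B where "B = sqrt b *\<^sub>R (id_blinfun - Y)"
  have "E + (Y o\<^sub>L Y) = 2 *\<^sub>R f Y" by (simp add: f_def)
  then have "E + (Y o\<^sub>L Y) = Y + Y" by (simp add: Y(2) scaleR_2)
  then have "Y o\<^sub>L Y = Y + Y - id_blinfun + (1 / b) *\<^sub>R A" by (simp add: E_def algebra_simps)
  then have "B o\<^sub>L B = A"
    using b by (simp add: B_def compose_simps scaleR_right_distrib scaleR_right_diff_distrib)
  moreover have "B \<in> PD"
  proof (rule coercive_PD)
    have "(1 - p) * (norm x)\<^sup>2 \<le> rinner (blinfun_apply (id_blinfun - Y) x) x" for x
      using norm_quadratic_form_le[of Y x] mult_right_mono[of "norm Y" p "(norm x)\<^sup>2"] Y(1)
      by (simp add: K_def blinfun.bilinear_simps rinner_simps rinner_same algebra_simps)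
    then show "coercive (sqrt b * (1 - p)) B"
      using Y(1) b by (auto simp: coercive_def B_def K_def self_adjoint_scaleR self_adjoint_diff
          self_adjoint_id blinfun.scaleR_left rinner_scaleR_left mult.assoc)
    show "0 < sqrt b * (1 - p)" using b p by simp
  qed
  ultimately show ?thesis using that by blast
qed

lemma PD_of_square:
  assumes "pos_semidef B" "B o\<^sub>L B \<in> PD"
  shows "B \<in> PD"
proof -
  define A where "A = B o\<^sub>L B"
  have A: "A o\<^sub>L op_inv A = id_blinfun" "op_inv A o\<^sub>L A = id_blinfun"
    using PD_op_inv assms(2) by (auto simp: A_def)
  have right: "B o\<^sub>L (B o\<^sub>L op_inv A) = id_blinfun"
    using A(1) by (simp add: A_def blinfun_compose_assoc)
  have left: "(op_inv A o\<^sub>L B) o\<^sub>L B = id_blinfun"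
    using A(2) by (simp add: A_def blinfun_compose_assoc)
  have "op_inv A o\<^sub>L B = ((op_inv A o\<^sub>L B) o\<^sub>L B) o\<^sub>L (B o\<^sub>L op_inv A)"
    using right by (metis blinfun_compose_assoc id_blinfun_compose(2))
  then have "op_inv A o\<^sub>L B = B o\<^sub>L op_inv A" using left by simp
  then have "op_invertible B" using left right unfolding op_invertible_def by metis
  then show ?thesis using assms(1) by (simp add: PD_def)
qed

lemma PD_op_sqrt:
  assumes "A \<in> PD"
  shows "op_sqrt A \<in> PD" "op_sqrt A o\<^sub>L op_sqrt A = A"
proof -
  obtain B where B: "B \<in> PD" "B o\<^sub>L B = A" using PD_square_root_exists[OF assms] .
  have "op_sqrt A = B"
    unfolding op_sqrt_def
  proof (rule the_equality)
    fix C assume C: "pos_semidef C \<and> C o\<^sub>L C = A"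
    then have "C \<in> PD" using PD_of_square assms by blast
    then show "C = B" using PD_square_inject B C by metis
  qed (use B PD_pos_semidef in blast)
  then show "op_sqrt A \<in> PD" "op_sqrt A o\<^sub>L op_sqrt A = A" using B by auto
qed

text \<open>The mean \<open>Z = A\<^sup>-\<^sup>1 # B\<close> solves the Riccati equation \<open>Z A Z = B\<close>.  Every use of the near-order
  below goes through this congruence with \<open>Z \<ge> 1\<close>.\<close>

lemma near_leD:
  assumes A: "A \<in> PD" and B: "B \<in> PD" and "A \<preceq>\<^sub>N B"
  obtains Z where "coercive 1 Z" "Z o\<^sub>L A o\<^sub>L Z = B"
proof
  define R where "R = op_sqrt (op_inv A)"
  define Q where "Q = op_inv R"
  define N where "N = op_sqrt (Q o\<^sub>L B o\<^sub>L Q)"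
  have R: "R \<in> PD" "R o\<^sub>L R = op_inv A"
    unfolding R_def by (intro PD_op_sqrt op_inv_PD A)+
  have Q: "Q \<in> PD" "R o\<^sub>L Q = id_blinfun" "Q o\<^sub>L R = id_blinfun"
    unfolding Q_def by (intro op_inv_PD PD_op_inv R(1))+
  have N: "N o\<^sub>L N = Q o\<^sub>L B o\<^sub>L Q"
    unfolding N_def by (intro PD_op_sqrt PD_conjugate Q B)
  have "A = op_inv (R o\<^sub>L R)" using R(2) op_inv_op_inv[OF A] by simp
  also have "\<dots> = Q o\<^sub>L Q"
    by (rule op_inv_eqI) (simp_all add: blinfun_compose_assoc compose_eq_left[OF Q(2)]
        compose_eq_left[OF Q(3)] Q)
  finally have AQ: "A = Q o\<^sub>L Q" .
  have geo: "geo_mean (op_inv A) B = R o\<^sub>L N o\<^sub>L R"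
    by (simp add: geo_mean_def N_def Q_def R_def)
  show "coercive 1 (R o\<^sub>L N o\<^sub>L R)"
    using assms(3) by (simp add: near_le_def geo id_loewner_le_iff)
  show "(R o\<^sub>L N o\<^sub>L R) o\<^sub>L A o\<^sub>L (R o\<^sub>L N o\<^sub>L R) = B"
    by (simp add: AQ blinfun_compose_assoc compose_eq_left[OF Q(2)] compose_eq_left[OF Q(3)]
        compose_eq_left[OF N] Q)
qed

text \<open>Write \<open>G = Z H Z\<close> and \<open>M = W G W\<close> with \<open>Z, W \<ge> 1\<close>, and put \<open>D = W\<^sup>-\<^sup>1\<close>.  Then
  \<open>0 \<le> D \<le> 1 \<le> Z\<close> and \<open>Z H Z - D H D = D (M - H) D\<close>.  In terms of \<open>S = Z + D\<close> and
  \<open>T = Z - D\<close> the left side is half of \<open>S H T + T H S\<close>, so the Lyapunov bound controls \<open>T\<close>, and with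
  it \<open>Z - 1 \<le> T\<close>, by a multiple of \<open>\<parallel>M - H\<parallel>\<close>.  An a priori bound for \<open>Z\<close> comes from
  \<open>c \<parallel>Z x\<parallel>\<^sup>2 \<le> \<langle>G x, x\<rangle> = \<langle>M D x, D x\<rangle> \<le> b \<parallel>x\<parallel>\<^sup>2\<close>.\<close>

lemma near_order_sandwich_norm_le:
  assumes H: "coercive c H" "0 < c" and G: "G \<in> PD" and M: "M \<in> PD"
    and b: "norm H \<le> b" "norm M \<le> b"
    and HG: "H \<preceq>\<^sub>N G" and GM: "G \<preceq>\<^sub>N M"
  shows "norm (G - H) \<le> b * (sqrt (b / c) + 1)\<^sup>2 / c * norm (M - H)"
proof -
  have H_PD: "H \<in> PD" using H by (rule coercive_PD)
  have b0: "0 \<le> b" using b(1) norm_ge_zero order_trans by blast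
  obtain Z where Z: "coercive 1 Z" "Z o\<^sub>L H o\<^sub>L Z = G" using near_leD[OF H_PD G HG] .
  obtain W where W: "coercive 1 W" "W o\<^sub>L G o\<^sub>L W = M" using near_leD[OF G M GM] .
  have sa: "self_adjoint Z" "self_adjoint H" "self_adjoint W"
    using Z(1) W(1) H(1) coercive_self_adjoint by blast+
  have W_PD: "W \<in> PD" using coercive_PD[OF W(1)] by simp
  define D where "D = op_inv W"
  have D_PD: "D \<in> PD" unfolding D_def using W_PD by (rule op_inv_PD)
  have DW: "D o\<^sub>L W = id_blinfun" "W o\<^sub>L D = id_blinfun"
    unfolding D_def using PD_op_inv W_PD by blast+
  have D1: "norm D \<le> 1" unfolding D_def using norm_op_inv_le[OF W(1)] by simp
  have D_sa: "self_adjoint D" using D_PD by (rule PD_self_adjoint)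
  have D0: "0 \<le> rinner (blinfun_apply D x) x" for x
    using PD_pos_semidef[OF D_PD] by (simp add: pos_semidef_def rinner_def)
  have D_le: "rinner (blinfun_apply D x) x \<le> (norm x)\<^sup>2" for x
    using norm_quadratic_form_le[of D x] mult_right_mono[OF D1, of "(norm x)\<^sup>2"] by simp
  have Z_ge: "(norm x)\<^sup>2 \<le> rinner (blinfun_apply Z x) x" for x
    using coerciveD[OF Z(1), of x] by simp
  have GD: "G = D o\<^sub>L M o\<^sub>L D"
    by (simp add: blinfun_compose_assoc compose_eq_left[OF DW(1)] DW flip: W(2))
  define z where "z = sqrt (b / c)"
  have z0: "0 \<le> z" using b0 H by (simp add: z_def)
  have Z_le: "norm Z \<le> z"
  proof (rule norm_blinfun_bound[OF z0])
    fix x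
    let ?Zx = "blinfun_apply Z x" and ?Dx = "blinfun_apply D x"
    have "c * (norm ?Zx)\<^sup>2 \<le> rinner (blinfun_apply H ?Zx) ?Zx" by (rule coerciveD[OF H(1)])
    also have "\<dots> = rinner (blinfun_apply G x) x"
      using rinner_self_adjoint[OF sa(1)] by (simp flip: Z(2))
    also have "\<dots> = rinner (blinfun_apply M ?Dx) ?Dx"
      using rinner_self_adjoint[OF D_sa] by (simp add: GD)
    also have "\<dots> \<le> norm M * (norm ?Dx)\<^sup>2"
      using norm_quadratic_form_le[of M ?Dx] by linarith
    also have "\<dots> \<le> b * (norm x)\<^sup>2"
    proof -
      have "norm ?Dx \<le> norm x"
        using norm_blinfun[of D x] mult_right_mono[OF D1, of "norm x"] by simp
      then show ?thesis by (intro mult_mono power_mono b b0) auto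
    qed
    finally have "(norm ?Zx)\<^sup>2 \<le> (z * norm x)\<^sup>2"
      using b0 H by (simp add: z_def power_mult_distrib field_simps)
    then show "norm ?Zx \<le> z * norm x"
      by (rule power2_le_imp_le) (simp add: z0)
  qed
  define S where "S = Z + D"
  define T where "T = Z - D"
  have S: "coercive 1 S"
    using D0 Z_ge sa D_sa by (auto simp: S_def coercive_def self_adjoint_add
        blinfun.bilinear_simps rinner_simps intro: add_increasing2)
  have T: "pos_semidef T"
    using order_trans[OF D_le Z_ge] sa D_sa by (simp add: T_def pos_semidef_iff_coercive
        coercive_def self_adjoint_diff blinfun.bilinear_simps rinner_simps)
  define e where "e = norm (M - H)"
  have "(S o\<^sub>L H o\<^sub>L T) + (T o\<^sub>L H o\<^sub>L S) = 2 *\<^sub>R ((Z o\<^sub>L H o\<^sub>L Z) - (D o\<^sub>L H o\<^sub>L D))"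
    by (simp add: S_def T_def compose_simps scaleR_2)
  also have "\<dots> = 2 *\<^sub>R (D o\<^sub>L (M - H) o\<^sub>L D)"
    by (simp add: Z(2) GD compose_simps)
  finally have "norm ((S o\<^sub>L H o\<^sub>L T) + (T o\<^sub>L H o\<^sub>L S)) \<le> 2 * e"
    using norm_compose_mono[OF norm_compose_mono[OF D1 order_refl] D1, of "M - H"]
    by (simp add: e_def)
  from Lyapunov_bound[OF S H _ this]
  have TS: "rinner (blinfun_apply T x) x \<le> e / c * rinner (blinfun_apply S x) x" for x
    using T by (simp add: pos_semidef_def)
  have T_le: "norm T \<le> e / c * (z + 1)"
  proof (rule pos_semidef_norm_le[OF T])
    have ec: "0 \<le> e / c" using H by (simp add: e_def)
    then show "0 \<le> e / c * (z + 1)" using z0 by (intro mult_nonneg_nonneg) auto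
    fix x
    have "norm S \<le> z + 1" unfolding S_def by (intro norm_triangle_mono Z_le D1)
    then have "rinner (blinfun_apply S x) x \<le> (z + 1) * (norm x)\<^sup>2"
      using norm_quadratic_form_le[of S x] mult_right_mono[of "norm S" "z + 1" "(norm x)\<^sup>2"]
      by simp
    then show "rinner (blinfun_apply T x) x \<le> e / c * (z + 1) * (norm x)\<^sup>2"
      using TS[of x] mult_left_mono[OF _ ec] by (fastforce simp: mult.assoc)
  qed
  have "norm (Z - id_blinfun) \<le> norm T"
  proof (rule pos_semidef_norm_mono)
    show "pos_semidef (Z - id_blinfun)"
      using Z(1) by (simp add: loewner_le_def flip: id_loewner_le_iff)
    show "rinner (blinfun_apply (Z - id_blinfun) x) x \<le> rinner (blinfun_apply T x) x" for x
      using D_le[of x] by (simp add: T_def blinfun.bilinear_simps rinner_simps rinner_same)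
  qed
  then have ZI: "norm (Z - id_blinfun) \<le> e / c * (z + 1)" using T_le by linarith
  have "G - H = ((Z - id_blinfun) o\<^sub>L H o\<^sub>L Z) + (H o\<^sub>L (Z - id_blinfun))"
    by (simp add: compose_simps Z(2)[unfolded blinfun_compose_assoc] blinfun_compose_assoc)
  also have "norm \<dots> \<le> e / c * (z + 1) * b * z + b * (e / c * (z + 1))"
    by (intro norm_triangle_mono norm_compose_mono ZI b Z_le)
  finally have "norm (G - H) \<le> b * (z + 1)\<^sup>2 / c * e"
    by (simp add: power2_eq_square algebra_simps add_divide_distrib)
  then show ?thesis by (simp only: e_def z_def)
qed

section \<open>Arithmetic and harmonic means near a constant tuple\<close>

lemma norm_convex_sum_le:
  assumes "w \<in> prob_vectors" "\<And>i. norm (f i) \<le> b"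
  shows "norm (\<Sum>i\<in>UNIV. w $ i *\<^sub>R f i) \<le> b"
proof -
  have w: "\<And>i. 0 < w $ i" "(\<Sum>i\<in>UNIV. w $ i) = 1" using assms(1) by (auto simp: prob_vectors_def)
  have "norm (\<Sum>i\<in>UNIV. w $ i *\<^sub>R f i) \<le> (\<Sum>i\<in>UNIV. w $ i * b)"
    using w(1) assms(2) by (intro sum_norm_le) (simp add: mult_left_mono less_imp_le)
  then show ?thesis by (simp add: w(2) flip: sum_distrib_right)
qed

lemma rinner_sum_left: "rinner (\<Sum>i\<in>I. f i) y = (\<Sum>i\<in>I. rinner (f i) y)"
  by (induction I rule: infinite_finite_induct) (simp_all add: rinner_add_left)

lemma coercive_convex_sum:
  assumes "w \<in> prob_vectors" "\<And>i. coercive c (f i)"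
  shows "coercive c (\<Sum>i\<in>UNIV. w $ i *\<^sub>R f i)"
  unfolding coercive_def
proof (intro conjI allI)
  have w: "\<And>i. 0 < w $ i" "(\<Sum>i\<in>UNIV. w $ i) = 1" using assms(1) by (auto simp: prob_vectors_def)
  show "self_adjoint (\<Sum>i\<in>UNIV. w $ i *\<^sub>R f i)"
    using assms(2) by (intro self_adjoint_sum self_adjoint_scaleR coercive_self_adjoint)
  fix x
  have "(\<Sum>i\<in>UNIV. w $ i * (c * (norm x)\<^sup>2)) \<le> (\<Sum>i\<in>UNIV. w $ i * rinner (blinfun_apply (f i) x) x)"
    using w(1) assms(2) by (intro sum_mono mult_left_mono coerciveD) (auto intro: less_imp_le)
  then show "c * (norm x)\<^sup>2 \<le> rinner (blinfun_apply (\<Sum>i\<in>UNIV. w $ i *\<^sub>R f i) x) x"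
    by (simp add: w(2) blinfun.sum_left rinner_sum_left blinfun.scaleR_left rinner_scaleR_left
        flip: sum_distrib_right)
qed

lemmas sum_compose =
  bounded_bilinear.sum_left[OF bounded_bilinear_blinfun_compose]
  bounded_bilinear.sum_right[OF bounded_bilinear_blinfun_compose]

text \<open>The two means agree to first order: with \<open>B\<^sub>i = A\<^sub>i\<^sup>-\<^sup>1\<close>, the arithmetic mean \<open>M\<close> and
  \<open>B = \<Sum> w\<^sub>i B\<^sub>i\<close>, one has
  \<open>M B - 1 = \<Sum> w\<^sub>i (M - A\<^sub>i) (B\<^sub>i - X\<^sup>-\<^sup>1) = \<Sum> w\<^sub>i (M - A\<^sub>i) B\<^sub>i (X - A\<^sub>i) X\<^sup>-\<^sup>1\<close>
  because \<open>\<Sum> w\<^sub>i (M - A\<^sub>i) = 0\<close>, and every summand is quadratic in the distance of the tuple from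
  the constant tuple \<open>X\<close>.\<close>

lemma arith_harm_mean_bounds:
  fixes A :: "'a::complex_hilbert_space oper ^ 'n"
  assumes w: "w \<in> prob_vectors" and c: "0 < c" and b: "0 < b"
    and A: "\<And>i. coercive c (A $ i)" "\<And>i. norm (A $ i) \<le> b"
    and X: "coercive c X" and d: "\<And>i. norm (A $ i - X) \<le> d"
  shows "coercive c (arith_mean w A)" "norm (arith_mean w A) \<le> b"
    and "coercive c (harm_mean w A)" "norm (harm_mean w A) \<le> b"
    and "norm (arith_mean w A - harm_mean w A) \<le> 2 * b / c\<^sup>2 * d\<^sup>2"
proof -
  have w1: "(\<Sum>i\<in>UNIV. w $ i) = 1" using w by (simp add: prob_vectors_def)
  have A_PD: "A $ i \<in> PD" for i using coercive_PD A(1) c by blast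
  define M where "M = arith_mean w A"
  define B where "B = (\<Sum>i\<in>UNIV. w $ i *\<^sub>R op_inv (A $ i))"
  have B_coercive: "coercive (1 / b) B"
    unfolding B_def by (intro coercive_convex_sum w coercive_op_inv A_PD A b)
  have B_norm: "norm B \<le> 1 / c"
    unfolding B_def by (intro norm_convex_sum_le w norm_op_inv_le A c)
  have B_PD: "B \<in> PD" using coercive_PD[OF B_coercive] b by simp
  have H_def: "harm_mean w A = op_inv B" by (simp add: harm_mean_def B_def)
  show "coercive c (arith_mean w A)" "norm (arith_mean w A) \<le> b"
    unfolding arith_mean_def by (intro coercive_convex_sum norm_convex_sum_le w A)+
  show "coercive c (harm_mean w A)"
    unfolding H_def using coercive_op_inv[OF B_PD B_norm] c by simp
  show H_norm: "norm (harm_mean w A) \<le> b"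
    unfolding H_def using norm_op_inv_le[OF B_coercive] b by simp
  have X_inv: "X o\<^sub>L op_inv X = id_blinfun" using PD_op_inv coercive_PD[OF X c] by blast
  have d0: "0 \<le> d" using d norm_ge_zero order_trans by blast
  have summand: "(M - A $ i) o\<^sub>L (op_inv (A $ i) - op_inv X)
      = (M - A $ i) o\<^sub>L (op_inv (A $ i) o\<^sub>L (X - A $ i) o\<^sub>L op_inv X)" for i
    using PD_op_inv[OF A_PD[of i]] X_inv
    by (simp add: compose_simps blinfun_compose_assoc compose_eq_left)
  have "(M o\<^sub>L B) - id_blinfun
      = (\<Sum>i\<in>UNIV. w $ i *\<^sub>R ((M - A $ i) o\<^sub>L (op_inv (A $ i) - op_inv X)))"
  proof -
    have "w $ i *\<^sub>R ((M - A $ i) o\<^sub>L (op_inv (A $ i) - op_inv X))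
        = w $ i *\<^sub>R (M o\<^sub>L op_inv (A $ i)) - w $ i *\<^sub>R id_blinfun
          - ((w $ i *\<^sub>R (M - A $ i)) o\<^sub>L op_inv X)" for i
      using PD_op_inv(1)[OF A_PD[of i]] by (simp add: compose_simps scaleR_right_diff_distrib)
    then have "(\<Sum>i\<in>UNIV. w $ i *\<^sub>R ((M - A $ i) o\<^sub>L (op_inv (A $ i) - op_inv X)))
        = (\<Sum>i\<in>UNIV. w $ i *\<^sub>R (M o\<^sub>L op_inv (A $ i))) - (\<Sum>i\<in>UNIV. w $ i *\<^sub>R id_blinfun)
          - ((\<Sum>i\<in>UNIV. w $ i *\<^sub>R (M - A $ i)) o\<^sub>L op_inv X)"
      by (simp only: sum_subtractf sum_compose)
    also have "(\<Sum>i\<in>UNIV. w $ i *\<^sub>R (M - A $ i)) = 0"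
      by (simp add: scaleR_right_diff_distrib sum_subtractf w1 M_def arith_mean_def
          flip: scaleR_sum_left)
    also have "(\<Sum>i\<in>UNIV. w $ i *\<^sub>R (M o\<^sub>L op_inv (A $ i))) = M o\<^sub>L B"
      by (simp add: B_def sum_compose compose_simps)
    finally show ?thesis by (simp add: w1 flip: scaleR_sum_left)
  qed
  also have "norm \<dots> \<le> 2 * d * (1 / c * d * (1 / c))"
  proof (rule norm_convex_sum_le[OF w])
    fix i
    have "norm (M - A $ i) \<le> 2 * d"
    proof -
      have "norm (\<Sum>j\<in>UNIV. w $ j *\<^sub>R (A $ j - X)) \<le> d"
        by (intro norm_convex_sum_le w d)
      also have "(\<Sum>j\<in>UNIV. w $ j *\<^sub>R (A $ j - X)) = M - X"
        by (simp add: scaleR_right_diff_distrib sum_subtractf w1 M_def arith_mean_def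
            flip: scaleR_sum_left)
      finally have "norm (M - X) \<le> d" .
      then show ?thesis using d[of i] norm_triangle_ineq4[of "M - X" "A $ i - X"] by simp
    qed
    then show "norm ((M - A $ i) o\<^sub>L (op_inv (A $ i) - op_inv X)) \<le> 2 * d * (1 / c * d * (1 / c))"
      unfolding summand using d[of i]
      by (intro norm_compose_mono norm_op_inv_le A X c) (simp_all add: norm_minus_commute)
  qed
  finally have MB: "norm ((M o\<^sub>L B) - id_blinfun) \<le> 2 * d * (1 / c * d * (1 / c))" .
  have "M - harm_mean w A = ((M o\<^sub>L B) - id_blinfun) o\<^sub>L harm_mean w A"
    using PD_op_inv[OF B_PD] by (simp add: H_def compose_simps blinfun_compose_assoc)
  also have "norm \<dots> \<le> 2 * d * (1 / c * d * (1 / c)) * b"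
    by (intro norm_compose_mono MB H_norm)
  finally show "norm (arith_mean w A - harm_mean w A) \<le> 2 * b / c\<^sup>2 * d\<^sup>2"
    by (simp add: M_def power2_eq_square field_simps)
qed

section \<open>Differentiability at constant tuples\<close>

lemma coercive_perturb:
  assumes "coercive c X" "self_adjoint A" "norm (A - X) \<le> d"
  shows "coercive (c - d) A"
  unfolding coercive_def
proof (intro conjI allI assms(2))
  fix x
  have "- (d * (norm x)\<^sup>2) \<le> rinner (blinfun_apply (A - X) x) x"
    using norm_quadratic_form_le[of "A - X" x] mult_right_mono[OF assms(3), of "(norm x)\<^sup>2"]
    by simp
  then show "(c - d) * (norm x)\<^sup>2 \<le> rinner (blinfun_apply A x) x"
    using coerciveD[OF assms(1), of x]
    by (simp add: blinfun.bilinear_simps rinner_simps algebra_simps)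
qed

lemma bounded_linear_arith_mean: "bounded_linear (arith_mean w)"
  unfolding arith_mean_def[abs_def]
  by (intro bounded_linear_sum bounded_linear_compose[OF bounded_linear_scaleR_right]
      bounded_linear_vec_nth)

lemma arith_mean_const: "w \<in> prob_vectors \<Longrightarrow> arith_mean w (\<chi> i. X) = X"
  by (simp add: arith_mean_def prob_vectors_def flip: scaleR_sum_left)

text \<open>The arithmetic mean \<open>M\<close> is linear, and near a constant tuple \<open>G\<close> differs from it by at
  most \<open>\<parallel>G - H\<parallel> + \<parallel>M - H\<parallel>\<close>, which is quadratically small.\<close>

lemma near_order_mean_has_derivative:
  fixes w :: "real ^ 'n"
    and G :: "'a::complex_hilbert_space oper ^ 'n \<Rightarrow> 'a oper"
  assumes w: "w \<in> prob_vectors" and G: "weighted_mean G"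
    and AGH: "\<And>A. A \<in> PD_tuples \<Longrightarrow> harm_mean w A \<preceq>\<^sub>N G A \<and> G A \<preceq>\<^sub>N arith_mean w A"
    and X: "X \<in> PD"
  shows "(G has_derivative arith_mean w) (at (\<chi> i. X) within PD_tuples)"
proof -
  obtain a where a: "0 < a" "coercive a X" using X PD_iff_coercive by blast
  \<comment> \<open>Within distance \<open>a / 2\<close> of \<open>X \<ge> a\<close>, all entries of the tuple are still at least \<open>a / 2\<close>.\<close>
  define c where "c = a / 2"
  define b where "b = norm X + c"
  define K where "K = (b * (sqrt (b / c) + 1)\<^sup>2 / c + 1) * (2 * b / c\<^sup>2)"
  have c: "0 < c" "c \<le> a" using a by (auto simp: c_def)
  have b: "0 < b" using c by (auto simp: b_def add_nonneg_pos)
  have K: "0 \<le> K" using b c by (simp add: K_def)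
  have quadratic: "norm (G A - arith_mean w A) \<le> K * (norm (A - (\<chi> i. X)))\<^sup>2"
    if A: "A \<in> PD_tuples" and near: "norm (A - (\<chi> i. X)) \<le> c" for A
  proof -
    define d where "d = norm (A - (\<chi> i. X))"
    have Ai: "A $ i \<in> PD" for i using A by (simp add: PD_tuples_def)
    have d: "norm (A $ i - X) \<le> d" for i
      using Finite_Cartesian_Product.norm_nth_le[of "A - (\<chi> i. X)" i] by (simp add: d_def)
    have dc: "norm (A $ i - X) \<le> c" for i using d[of i] near by (simp add: d_def)
    have cA: "coercive c (A $ i)" for i
      using coercive_perturb[OF a(2) PD_self_adjoint[OF Ai] dc, of i] by (simp add: c_def)
    have bA: "norm (A $ i) \<le> b" for i
      using norm_triangle_sub[of "A $ i" X] dc[of i] by (simp add: b_def)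
    have cX: "coercive c X" using a(2) c(2) by (rule coercive_mono)
    note AH = arith_harm_mean_bounds[OF w c(1) b cA bA cX d]
    let ?M = "arith_mean w A" and ?H = "harm_mean w A"
    have "norm (G A - ?H) \<le> b * (sqrt (b / c) + 1)\<^sup>2 / c * norm (?M - ?H)"
      using G A AGH[OF A] coercive_PD[OF AH(1) c(1)]
      by (intro near_order_sandwich_norm_le AH c) (auto simp: weighted_mean_def)
    then have "norm (G A - ?M) \<le> (b * (sqrt (b / c) + 1)\<^sup>2 / c + 1) * norm (?M - ?H)"
      using norm_triangle_ineq4[of "G A - ?H" "?M - ?H"] by (simp add: algebra_simps)
    also have "\<dots> \<le> (b * (sqrt (b / c) + 1)\<^sup>2 / c + 1) * (2 * b / c\<^sup>2 * d\<^sup>2)"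
      using b c by (intro mult_left_mono AH) simp
    finally show ?thesis by (simp add: K_def d_def mult.assoc)
  qed
  show ?thesis
    unfolding has_derivative_within_alt2
  proof (intro conjI allI impI bounded_linear_arith_mean)
    fix e :: real assume e: "0 < e"
    have GX: "G (\<chi> i. X) = X" using G X by (simp add: weighted_mean_def)
    define r where "r = min c (e / (K + 1))"
    have "0 < r" using c e K by (simp add: r_def)
    moreover have "norm (G A - G (\<chi> i. X) - arith_mean w (A - (\<chi> i. X))) \<le> e * norm (A - (\<chi> i. X))"
      if "A \<in> PD_tuples" "norm (A - (\<chi> i. X)) < r" for A
    proof -
      have "arith_mean w (A - (\<chi> i. X)) = arith_mean w A - X"
        using linear_diff[OF bounded_linear.linear[OF bounded_linear_arith_mean]]
        by (metis arith_mean_const[OF w])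
      then have "norm (G A - G (\<chi> i. X) - arith_mean w (A - (\<chi> i. X))) = norm (G A - arith_mean w A)"
        by (simp add: GX)
      also have "\<dots> \<le> K * (norm (A - (\<chi> i. X)))\<^sup>2"
        using that by (intro quadratic) (auto simp: r_def)
      also have "\<dots> \<le> e * norm (A - (\<chi> i. X))"
      proof -
        have "(K + 1) * norm (A - (\<chi> i. X)) \<le> e"
          using that(2) K by (simp add: r_def field_simps)
        then have "K * norm (A - (\<chi> i. X)) \<le> e"
          by (simp add: distrib_right add_increasing2 order_trans[rotated])
        then show ?thesis
          using mult_right_mono[of "K * norm (A - (\<chi> i. X))" e "norm (A - (\<chi> i. X))"]
          by (simp add: power2_eq_square mult.assoc)
      qed
      finally show ?thesis .
    qed
    ultimately show "\<forall>\<^sub>F A in at (\<chi> i. X) within PD_tuples.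
        norm (G A - G (\<chi> i. X) - arith_mean w (A - (\<chi> i. X))) \<le> e * norm (A - (\<chi> i. X))"
      unfolding eventually_at dist_norm by blast
  qed
qed

section \<open>Exponentials and logarithms of self-adjoint operators\<close>

definition op_pow :: "'a::complex_hilbert_space oper \<Rightarrow> nat \<Rightarrow> 'a oper"
  where "op_pow A k = ((\<lambda>B. A o\<^sub>L B) ^^ k) id_blinfun"

lemma op_pow_0 [simp]: "op_pow A 0 = id_blinfun"
  by (simp add: op_pow_def)

lemma op_pow_Suc: "op_pow A (Suc k) = A o\<^sub>L op_pow A k"
  by (simp add: op_pow_def)

lemma op_pow_add: "op_pow A (j + k) = op_pow A j o\<^sub>L op_pow A k"
  by (induction j) (simp_all add: op_pow_Suc blinfun_compose_assoc)

lemma op_pow_commute: "A o\<^sub>L op_pow A k = op_pow A k o\<^sub>L A"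
  using op_pow_add[of A k 1] op_pow_add[of A 1 k] by (simp add: op_pow_Suc)

lemma op_pow_scaleR: "op_pow (r *\<^sub>R A) k = r ^ k *\<^sub>R op_pow A k"
  by (induction k) (simp_all add: op_pow_Suc compose_simps mult.commute)

lemma norm_op_pow_le:
  assumes "norm A \<le> r"
  shows "norm (op_pow A k) \<le> r ^ k"
  by (induction k) (auto simp: op_pow_Suc norm_blinfun_id_le intro: norm_compose_mono assms)

lemma self_adjoint_op_pow: "self_adjoint A \<Longrightarrow> self_adjoint (op_pow A k)"
  by (induction k) (simp_all add: op_pow_Suc self_adjoint_id self_adjoint_compose_commuting
      op_pow_commute)

lemma real_exp_sums: "(\<lambda>k. (1 / fact k) * r ^ k) sums exp r" for r :: real
  using exp_converges[of r] by (simp add: divide_inverse)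

lemma op_exp_sums: "(\<lambda>k. (1 / fact k) *\<^sub>R op_pow A k) sums op_exp A"
proof -
  have "summable (\<lambda>k. norm ((1 / fact k) *\<^sub>R op_pow A k))"
  proof (rule summable_comparison_test')
    show "summable (\<lambda>k. (1 / fact k) * norm A ^ k)"
      using real_exp_sums by (rule sums_summable)
    show "norm (norm ((1 / fact k) *\<^sub>R op_pow A k)) \<le> (1 / fact k) * norm A ^ k" for k
      using mult_left_mono[OF norm_op_pow_le[OF order_refl, of A k], of "1 / fact k"] by simp
  qed
  then show ?thesis
    unfolding op_exp_def op_pow_def by (rule summable_sums[OF summable_norm_cancel])
qed

lemma self_adjoint_op_exp:
  assumes "self_adjoint A" shows "self_adjoint (op_exp A)"
proof -
  have "self_adjoint (\<Sum>k<n. (1 / fact k) *\<^sub>R op_pow A k)" for n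
    by (intro self_adjoint_sum self_adjoint_scaleR self_adjoint_op_pow assms)
  then have "op_exp A \<in> {B. self_adjoint B}"
    by (intro closed_sequentially[OF closed_self_adjoint _ op_exp_sums[unfolded sums_def]]) simp
  then show ?thesis by simp
qed

lemma op_exp_zero: "op_exp 0 = id_blinfun"
proof -
  have "op_pow (0 :: 'a oper) k = (if k = 0 then id_blinfun else 0)" for k
    by (cases k) (simp_all add: op_pow_Suc)
  then have "(\<lambda>k. (1 / fact k) *\<^sub>R op_pow (0 :: 'a oper) k) =
      (\<lambda>k. if k = 0 then id_blinfun else 0)"
    by auto
  then show ?thesis
    using op_exp_sums[of "0 :: 'a oper"] sums_single[of 0 "\<lambda>_. id_blinfun :: 'a oper"]
    by (simp add: sums_unique2)
qed

text \<open>The terms of the product of two partial sums form a square inside the triangle of indices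
  that belongs to a partial sum of the right side.  The terms in between are dominated in
  norm by those of the real exponential series, for which their sum tends to zero.\<close>

lemma op_exp_add_scaleR: "op_exp (s *\<^sub>R A) o\<^sub>L op_exp (t *\<^sub>R A) = op_exp ((s + t) *\<^sub>R A)"
proof -
  define g where "g = (\<lambda>(i, j). ((s ^ i / fact i) * (t ^ j / fact j)) *\<^sub>R op_pow A (i + j))"
  define h where "h = (\<lambda>(i, j). ((\<bar>s\<bar> ^ i / fact i) * (\<bar>t\<bar> ^ j / fact j)) * norm A ^ (i + j))"
  let ?Sq = "\<lambda>n::nat. {..n} \<times> {..n}"
  let ?Tr = "\<lambda>n::nat. {(i, j). i + j \<le> 2 * n}"
  have fin: "finite (?Tr n)" for n
    by (rule finite_subset[of _ "?Sq (2 * n)"]) auto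
  have sub: "?Sq n \<subseteq> ?Tr n" for n by auto
  have binom: "(\<Sum>i\<le>k. (x ^ i / fact i) * (y ^ (k - i) / fact (k - i))) = (x + y) ^ k / fact k"
    for x y :: real and k
  proof -
    have "(x + y) ^ k / fact k = (\<Sum>i\<le>k. real (k choose i) / fact k * (x ^ i * y ^ (k - i)))"
      by (simp add: binomial_ring sum_divide_distrib mult_ac)
    also have "\<dots> = (\<Sum>i\<le>k. (x ^ i / fact i) * (y ^ (k - i) / fact (k - i)))"
      by (intro sum.cong refl) (simp add: binomial_fact)
    finally show ?thesis ..
  qed
  have g_Tr: "sum g (?Tr n) = (\<Sum>k\<le>2 * n. (1 / fact k) *\<^sub>R op_pow ((s + t) *\<^sub>R A) k)" for n
  proof -
    have "sum g (?Tr n) = (\<Sum>k\<le>2 * n. \<Sum>i\<le>k. g (i, k - i))"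
      using sum.triangle_reindex_eq[of "\<lambda>i j. g (i, j)" "2 * n"] by simp
    also have "\<dots> = (\<Sum>k\<le>2 * n. (1 / fact k) *\<^sub>R op_pow ((s + t) *\<^sub>R A) k)"
      by (intro sum.cong refl) (simp add: g_def op_pow_scaleR binom[simplified] flip: scaleR_sum_left)
    finally show ?thesis .
  qed
  have h_Tr: "sum h (?Tr n) = (\<Sum>k\<le>2 * n. (1 / fact k) * ((\<bar>s\<bar> + \<bar>t\<bar>) * norm A) ^ k)" for n
  proof -
    have "sum h (?Tr n) = (\<Sum>k\<le>2 * n. \<Sum>i\<le>k. h (i, k - i))"
      using sum.triangle_reindex_eq[of "\<lambda>i j. h (i, j)" "2 * n"] by simp
    also have "\<dots> = (\<Sum>k\<le>2 * n. (1 / fact k) * ((\<bar>s\<bar> + \<bar>t\<bar>) * norm A) ^ k)"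
    proof (intro sum.cong refl)
      fix k
      have "(\<Sum>i\<le>k. h (i, k - i))
          = (\<Sum>i\<le>k. (\<bar>s\<bar> ^ i / fact i) * (\<bar>t\<bar> ^ (k - i) / fact (k - i))) * norm A ^ k"
        unfolding sum_distrib_right by (intro sum.cong refl) (simp add: h_def)
      then show "(\<Sum>i\<le>k. h (i, k - i)) = (1 / fact k) * ((\<bar>s\<bar> + \<bar>t\<bar>) * norm A) ^ k"
        by (simp only: binom) (simp add: power_mult_distrib)
    qed
    finally show ?thesis .
  qed
  have g_Sq: "sum g (?Sq n) = (\<Sum>i\<le>n. (1 / fact i) *\<^sub>R op_pow (s *\<^sub>R A) i) o\<^sub>L
      (\<Sum>j\<le>n. (1 / fact j) *\<^sub>R op_pow (t *\<^sub>R A) j)" for n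
    unfolding sum_compose(1) unfolding sum_compose(2)
    by (simp add: g_def compose_simps op_pow_scaleR op_pow_add mult_ac
        flip: sum.cartesian_product)
  have h_Sq: "sum h (?Sq n) = (\<Sum>i\<le>n. (1 / fact i) * (\<bar>s\<bar> * norm A) ^ i) *
      (\<Sum>j\<le>n. (1 / fact j) * (\<bar>t\<bar> * norm A) ^ j)" for n
    by (simp add: h_def sum_product power_mult_distrib power_add mult_ac
        flip: sum.cartesian_product)
  have double: "filterlim (\<lambda>n::nat. 2 * n) sequentially sequentially"
    by (rule filterlim_subseq) (simp add: strict_mono_def)
  have lim_h: "(\<lambda>n. sum h (?Tr n) - sum h (?Sq n)) \<longlonglongrightarrow> 0"
  proof -
    have "(\<lambda>n. sum h (?Tr n) - sum h (?Sq n)) \<longlonglongrightarrow>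
        exp ((\<bar>s\<bar> + \<bar>t\<bar>) * norm A) - exp (\<bar>s\<bar> * norm A) * exp (\<bar>t\<bar> * norm A)"
      unfolding h_Tr h_Sq
      by (intro tendsto_intros real_exp_sums[unfolded sums_def_le]
          filterlim_compose[OF real_exp_sums[unfolded sums_def_le] double])
    then show ?thesis by (simp add: distrib_right exp_add)
  qed
  have "(\<lambda>n. sum g (?Tr n) - sum g (?Sq n)) \<longlonglongrightarrow> 0"
  proof (rule Lim_null_comparison[OF always_eventually lim_h], intro allI)
    fix n
    have "norm (sum g (?Tr n - ?Sq n)) \<le> sum h (?Tr n - ?Sq n)"
    proof (rule sum_norm_le)
      fix p assume "p \<in> ?Tr n - ?Sq n"
      obtain i j where p: "p = (i, j)" by force
      have "norm (op_pow A (i + j)) \<le> norm A ^ (i + j)" by (rule norm_op_pow_le) simp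
      then show "norm (g p) \<le> h p"
        by (simp add: p g_def h_def abs_mult power_abs divide_right_mono mult_left_mono)
    qed
    then show "norm (sum g (?Tr n) - sum g (?Sq n)) \<le> sum h (?Tr n) - sum h (?Sq n)"
      by (simp add: sum_diff[OF fin sub])
  qed
  moreover have "(\<lambda>n. sum g (?Tr n) - sum g (?Sq n)) \<longlonglongrightarrow>
      op_exp ((s + t) *\<^sub>R A) - (op_exp (s *\<^sub>R A) o\<^sub>L op_exp (t *\<^sub>R A))"
    unfolding g_Tr g_Sq
    by (intro tendsto_intros bounded_bilinear.tendsto[OF bounded_bilinear_blinfun_compose]
        op_exp_sums[unfolded sums_def_le]
        filterlim_compose[OF op_exp_sums[unfolded sums_def_le] double])
  ultimately show ?thesis
    using LIMSEQ_unique by fastforce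
qed

lemma op_exp_PD:
  assumes "self_adjoint A" shows "op_exp A \<in> PD"
proof -
  \<comment> \<open>The exponential is the square of a self-adjoint operator, hence positive.\<close>
  let ?B = "op_exp ((1 / 2) *\<^sub>R A)"
  have BB: "?B o\<^sub>L ?B = op_exp A" by (simp add: op_exp_add_scaleR)
  have B: "self_adjoint ?B" by (intro self_adjoint_op_exp self_adjoint_scaleR assms)
  have "0 \<le> rinner (blinfun_apply (op_exp A) x) x" for x
    using rinner_self_adjoint[OF B] by (simp add: rinner_same flip: BB)
  then have "pos_semidef (op_exp A)"
    using assms by (simp add: pos_semidef_iff_coercive coercive_def self_adjoint_op_exp)
  moreover have "op_exp A o\<^sub>L op_exp (- A) = id_blinfun" "op_exp (- A) o\<^sub>L op_exp A = id_blinfun"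
    using op_exp_add_scaleR[of 1 A "-1"] op_exp_add_scaleR[of "-1" A 1]
    by (simp_all add: op_exp_zero)
  ultimately show ?thesis unfolding PD_def op_invertible_def by blast
qed

lemma norm_op_pow_diff_le:
  assumes "norm L \<le> r" "norm M \<le> r"
  shows "norm (op_pow L (Suc k) - op_pow M (Suc k)) \<le> real (Suc k) * r ^ k * norm (L - M)"
proof (induction k)
  case (Suc k)
  have "op_pow L (Suc (Suc k)) - op_pow M (Suc (Suc k))
      = (L o\<^sub>L (op_pow L (Suc k) - op_pow M (Suc k))) + ((L - M) o\<^sub>L op_pow M (Suc k))"
    by (simp add: op_pow_Suc compose_simps)
  also have "norm \<dots> \<le> r * (real (Suc k) * r ^ k * norm (L - M)) + norm (L - M) * r ^ Suc k"
    by (intro norm_triangle_mono norm_compose_mono assms Suc norm_op_pow_le order_refl)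
  finally show ?case by (simp add: algebra_simps)
qed (simp add: op_pow_Suc)

text \<open>Near \<open>0\<close> the exponential differs from \<open>L \<mapsto> 1 + L\<close> by a map with a small Lipschitz
  constant.  This makes it injective there and invertible by iteration.\<close>

lemma op_exp_remainder_Lipschitz:
  assumes "norm L \<le> r" "norm M \<le> r"
  shows "norm ((op_exp L - L) - (op_exp M - M)) \<le> (exp r - 1) * norm (L - M)"
proof -
  define f where "f = (\<lambda>k. (1 / fact k) *\<^sub>R op_pow L k - (1 / fact k) *\<^sub>R op_pow M k)"
  have f: "f sums (op_exp L - op_exp M)"
    unfolding f_def by (intro sums_diff op_exp_sums)
  have "(\<lambda>k. f (k + 2)) sums (op_exp L - op_exp M - (f 0 + f 1))"
    using sums_split_initial_segment[OF f, of 2] by (simp add: numeral_2_eq_2)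
  then have s1: "(\<lambda>k. f (k + 2)) sums ((op_exp L - L) - (op_exp M - M))"
    by (simp add: f_def op_pow_Suc algebra_simps)
  have "(\<lambda>k. (1 / fact (k + 1)) * r ^ (k + 1)) sums (exp r - 1)"
    using sums_split_initial_segment[OF real_exp_sums[of r], of 1] by simp
  then have s2: "(\<lambda>k. (1 / fact (k + 1)) * r ^ (k + 1) * norm (L - M)) sums ((exp r - 1) * norm (L - M))"
    by (rule sums_mult2)
  have le: "norm (f (k + 2)) \<le> (1 / fact (k + 1)) * r ^ (k + 1) * norm (L - M)" for k
  proof -
    have "f (k + 2) = (1 / fact (k + 2)) *\<^sub>R (op_pow L (Suc (k + 1)) - op_pow M (Suc (k + 1)))"
      by (simp add: f_def scaleR_right_diff_distrib)
    then have "norm (f (k + 2)) = (1 / fact (k + 2)) * norm (op_pow L (Suc (k + 1)) - op_pow M (Suc (k + 1)))"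
      by simp
    also have "\<dots> \<le> (1 / fact (k + 2)) * (real (Suc (k + 1)) * r ^ (k + 1) * norm (L - M))"
      by (intro mult_left_mono norm_op_pow_diff_le assms) simp
    also have "\<dots> = (1 / fact (k + 1)) * r ^ (k + 1) * norm (L - M)"
    proof -
      have "(fact (k + 2) :: real) = real (Suc (k + 1)) * fact (k + 1)"
        using fact_Suc[of "k + 1"] by simp
      then show ?thesis by (simp del: of_nat_Suc fact_Suc)
    qed
    finally show ?thesis .
  qed
  have "norm (\<Sum>k. f (k + 2)) \<le> (\<Sum>k. (1 / fact (k + 1)) * r ^ (k + 1) * norm (L - M))"
    using le sums_summable[OF s2] by (intro norm_suminf_le) auto
  then show ?thesis using s1 s2 by (simp add: sums_iff)
qed

lemma isCont_op_exp: "isCont op_exp (A :: 'a::complex_hilbert_space oper)"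
proof -
  define r where "r = norm A + 1"
  have "((\<lambda>L. op_exp L - op_exp A) \<longlongrightarrow> 0) (at A)"
  proof (rule Lim_null_comparison)
    show "\<forall>\<^sub>F L in at A. norm (op_exp L - op_exp A) \<le> exp r * norm (L - A)"
      unfolding eventually_at
    proof (intro exI[of _ 1] conjI ballI impI)
      fix L assume "L \<noteq> A \<and> dist L A < 1"
      then have "norm L \<le> r" using norm_triangle_sub[of L A] by (simp add: r_def dist_norm)
      then have "norm ((op_exp L - L) - (op_exp A - A)) \<le> (exp r - 1) * norm (L - A)"
        by (intro op_exp_remainder_Lipschitz) (simp_all add: r_def)
      then show "norm (op_exp L - op_exp A) \<le> exp r * norm (L - A)"
        using norm_triangle_ineq[of "(op_exp L - L) - (op_exp A - A)" "L - A"]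
        by (simp add: algebra_simps)
    qed simp
    have "((\<lambda>L. exp r * norm (L - A)) \<longlongrightarrow> exp r * norm (A - A)) (at A)"
      by (intro tendsto_intros)
    then show "((\<lambda>L. exp r * norm (L - A)) \<longlongrightarrow> 0) (at A)" by simp
  qed
  then show ?thesis unfolding isCont_def by (rule LIM_zero_cancel)
qed

text \<open>Since positive square roots are unique, \<open>exp L = exp M\<close> implies
  \<open>exp (L / 2\<^sup>k) = exp (M / 2\<^sup>k)\<close> for every \<open>k\<close>, and near \<open>0\<close> the exponential is injective.\<close>

lemma op_exp_inject_self_adjoint:
  assumes L: "self_adjoint L" and M: "self_adjoint M" and eq: "op_exp L = op_exp M"
  shows "L = M"
proof -
  have halves: "op_exp ((1 / 2 ^ k) *\<^sub>R L) = op_exp ((1 / 2 ^ k) *\<^sub>R M)" for k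
  proof (induction k)
    case (Suc k)
    have sq: "op_exp ((1 / 2 ^ Suc k) *\<^sub>R A) o\<^sub>L op_exp ((1 / 2 ^ Suc k) *\<^sub>R A)
        = op_exp ((1 / 2 ^ k) *\<^sub>R A)" for A :: "'a oper"
      by (simp add: op_exp_add_scaleR)
    show ?case
      by (rule PD_square_inject) (simp_all only: sq Suc op_exp_PD self_adjoint_scaleR L M)
  qed (simp add: eq)
  define r where "r = norm L + norm M + 1"
  have "(\<lambda>k. exp (r * (1 / 2) ^ k) - 1) \<longlonglongrightarrow> exp (r * 0) - 1"
    by (intro tendsto_intros LIMSEQ_power_zero) simp
  then have "\<forall>\<^sub>F k in sequentially. exp (r * (1 / 2) ^ k) - 1 < 1"
    by (rule order_tendstoD) simp
  then obtain k where k: "exp (r * (1 / 2) ^ k) - 1 < 1"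
    using eventually_happens by fastforce
  define L' where "L' = (1 / 2 ^ k) *\<^sub>R L"
  define M' where "M' = (1 / 2 ^ k) *\<^sub>R M"
  have "norm L' \<le> r * (1 / 2) ^ k" "norm M' \<le> r * (1 / 2) ^ k"
    by (simp_all add: L'_def M'_def r_def power_one_over divide_right_mono)
  then have "norm ((op_exp L' - L') - (op_exp M' - M')) \<le> (exp (r * (1 / 2) ^ k) - 1) * norm (L' - M')"
    by (rule op_exp_remainder_Lipschitz)
  then have "norm (L' - M') \<le> (exp (r * (1 / 2) ^ k) - 1) * norm (L' - M')"
    using halves[of k] by (simp add: L'_def M'_def norm_minus_commute)
  then have "norm (L' - M') = 0"
    using k by (metis mult_le_cancel_right1 norm_le_zero_iff norm_eq_zero linorder_not_le norm_ge_zero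
        order_le_less)
  then show ?thesis by (simp add: L'_def M'_def flip: scaleR_right_diff_distrib)
qed

text \<open>The equation \<open>exp L = A\<close> is a fixed point equation \<open>L = A - (exp L - L)\<close>, whose right side is a
  contraction of the self-adjoint ball of radius \<open>2 \<parallel>A - 1\<parallel>\<close>.  Comparing \<open>exp L\<close> once more with
  \<open>1 + L\<close> shows that \<open>log A\<close> is \<open>A - 1\<close> up to second order.\<close>

lemma op_log_near_id:
  fixes A :: "'a::complex_hilbert_space oper"
  assumes A: "self_adjoint A" and near: "norm (A - id_blinfun) \<le> 1 / 8"
  shows "norm (op_log A - (A - id_blinfun)) \<le> 8 * (norm (A - id_blinfun))\<^sup>2"
proof -
  define d where "d = norm (A - id_blinfun)"
  define r where "r = 2 * d"
  have r: "0 \<le> r" "r \<le> 1 / 4" using near by (auto simp: r_def d_def)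
  \<comment> \<open>The second bound is the contraction constant; it is why \<open>A\<close> has to be this close to \<open>1\<close>.\<close>
  have exp_r: "exp r - 1 \<le> 2 * r" "exp r - 1 \<le> 1 / 2"
  proof -
    have "exp r \<le> 1 + r + r\<^sup>2" using r by (intro exp_bound) auto
    moreover have "r\<^sup>2 \<le> r * (1 / 4)"
      using r unfolding power2_eq_square by (intro mult_left_mono) auto
    ultimately show "exp r - 1 \<le> 2 * r" "exp r - 1 \<le> 1 / 2" using r by linarith+
  qed
  define K where "K = {L :: 'a oper. self_adjoint L \<and> norm L \<le> r}"
  define f where "f = (\<lambda>L. A - (op_exp L - L))"
  have Lipschitz: "norm ((op_exp L - L) - (op_exp M - M)) \<le> 1 / 2 * norm (L - M)"
    if "L \<in> K" "M \<in> K" for L M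
    using op_exp_remainder_Lipschitz[of L r M] that
      mult_right_mono[OF exp_r(2), of "norm (L - M)"] by (simp add: K_def)
  have zero: "0 \<in> K" using r by (simp add: K_def self_adjoint_zero)
  have "closed K"
    unfolding K_def by (intro closed_Collect_conj closed_self_adjoint closed_Collect_le
        continuous_intros)
  then have "complete K" by (simp add: complete_eq_closed)
  moreover have "f L \<in> K" if L: "L \<in> K" for L
  proof -
    have "norm (f L) \<le> r"
    proof -
      have "f L = (A - id_blinfun) - ((op_exp L - L) - (op_exp 0 - 0))"
        by (simp add: f_def op_exp_zero)
      then have "norm (f L) \<le> d + 1 / 2 * norm (L - 0)"
        using norm_triangle_ineq4[of "A - id_blinfun" "(op_exp L - L) - (op_exp 0 - 0)"]
          Lipschitz[OF L zero] by (simp add: d_def)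
      then show ?thesis using L by (simp add: K_def r_def)
    qed
    then show ?thesis
      using L A by (simp add: K_def f_def self_adjoint_diff self_adjoint_op_exp)
  qed
  moreover have "dist (f L) (f M) \<le> 1 / 2 * dist L M" if "L \<in> K" "M \<in> K" for L M
  proof -
    have "f L - f M = - ((op_exp L - L) - (op_exp M - M))" by (simp add: f_def)
    then show ?thesis using Lipschitz[OF that] by (metis dist_norm norm_minus_cancel)
  qed
  ultimately have "\<exists>!L\<in>K. f L = L"
    using zero by (intro Banach_fix[of K "1 / 2" f]) auto
  then obtain L where L: "L \<in> K" "f L = L" by blast
  then have exp_L: "op_exp L = A" by (simp add: f_def algebra_simps)
  have "op_log A = L"
    unfolding op_log_def
  proof (rule the_equality)
    show "self_adjoint L \<and> op_exp L = A" using L(1) exp_L by (simp add: K_def)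
    then show "M = L" if "self_adjoint M \<and> op_exp M = A" for M
      using that op_exp_inject_self_adjoint by metis
  qed
  moreover have "norm (L - (A - id_blinfun)) \<le> 8 * d\<^sup>2"
  proof -
    have "norm ((op_exp L - L) - (op_exp 0 - 0)) \<le> (exp r - 1) * norm (L - 0)"
      using L(1) r by (intro op_exp_remainder_Lipschitz) (auto simp: K_def)
    also have "\<dots> \<le> 2 * r * r"
      using L(1) exp_r r by (intro mult_mono) (auto simp: K_def)
    finally show ?thesis
      by (simp add: op_exp_zero exp_L r_def power2_eq_square norm_minus_commute algebra_simps)
  qed
  ultimately show ?thesis by (simp add: d_def)
qed

section \<open>The Lie-Trotter formula\<close>

lemma has_vector_derivative_vec_lambda:
  fixes f :: "'n::finite \<Rightarrow> real \<Rightarrow> 'b::real_normed_vector"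
  assumes "\<And>i. (f i has_vector_derivative f' i) F"
  shows "((\<lambda>s. \<chi> i. f i s) has_vector_derivative (\<chi> i. f' i)) F"
proof -
  have axis_eq: "(\<chi> i. h i) = (\<Sum>i\<in>UNIV. axis i (h i))" for h :: "'n \<Rightarrow> 'b"
    by (simp add: vec_eq_iff axis_def if_distrib cong: if_cong)
  have axis: "bounded_linear (axis i :: 'b \<Rightarrow> 'b ^ 'n)" for i
  proof (rule bounded_linear_intro[where K = 1])
    show "axis i (x + y) = axis i x + axis i y" "axis i (r *\<^sub>R x) = r *\<^sub>R axis i x"
      for x y :: 'b and r by (simp_all add: vec_eq_iff axis_def)
    show "norm (axis i x :: 'b ^ 'n) \<le> norm x * 1" for x :: 'b
    proof -
      have "(\<Sum>j\<in>UNIV. norm (axis i x $ j)) = norm x"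
        by (simp add: axis_def if_distrib[where f = norm] cong: if_cong)
      then show ?thesis
        using L2_set_le_sum[of UNIV "\<lambda>j. norm (axis i x $ j)"] by (simp add: norm_vec_def)
    qed
  qed
  show ?thesis
    unfolding axis_eq
    by (rule has_vector_derivative_sum, rule bounded_linear.has_vector_derivative[OF axis assms])
qed

text \<open>A curve of self-adjoint operators through \<open>1\<close> and its logarithm have the same velocity
  there, and \<open>F(s)\<^bsup>1/s\<^esup> = exp (log F(s) / s)\<close>.\<close>

lemma op_powr_curve_tendsto:
  fixes F :: "real \<Rightarrow> 'a::complex_hilbert_space oper"
  assumes F: "(F has_vector_derivative M) (at 0)" and F0: "F 0 = id_blinfun"
    and sa: "\<forall>\<^sub>F s in at 0. self_adjoint (F s)"
  shows "((\<lambda>s. op_powr (F s) (1 / s)) \<longlongrightarrow> op_exp M) (at 0)"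
proof -
  let ?q = "\<lambda>s. (1 / s) *\<^sub>R (F s - id_blinfun)"
  have q: "(?q \<longlongrightarrow> M) (at 0)"
  proof -
    have "((\<lambda>s. norm (F s - id_blinfun - s *\<^sub>R M) / \<bar>s\<bar>) \<longlongrightarrow> 0) (at 0)"
      using F by (simp add: has_vector_derivative_def has_derivative_at F0)
    moreover have "\<forall>\<^sub>F s in at 0. norm (F s - id_blinfun - s *\<^sub>R M) / \<bar>s\<bar> = norm (?q s - M)"
      unfolding eventually_at
    proof (intro exI[of _ 1] conjI ballI impI)
      fix s :: real assume s: "s \<noteq> 0 \<and> dist s 0 < 1"
      then have "?q s - M = (1 / s) *\<^sub>R (F s - id_blinfun - s *\<^sub>R M)"
        by (simp add: scaleR_right_diff_distrib)
      then show "norm (F s - id_blinfun - s *\<^sub>R M) / \<bar>s\<bar> = norm (?q s - M)"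
        by simp
    qed simp
    ultimately have "((\<lambda>s. norm (?q s - M)) \<longlongrightarrow> 0) (at 0)"
      by (rule Lim_transform_eventually)
    then show ?thesis by (rule LIM_zero_cancel[OF tendsto_norm_zero_cancel])
  qed
  have "isCont F 0"
    using F has_vector_derivative_continuous by blast
  then have "((\<lambda>s. norm (F s - id_blinfun)) \<longlongrightarrow> norm (F 0 - id_blinfun)) (at 0)"
    unfolding isCont_def by (intro tendsto_intros)
  then have near: "\<forall>\<^sub>F s in at 0. norm (F s - id_blinfun) < 1 / 8"
    by (rule order_tendstoD) (simp add: F0)
  have "((\<lambda>s. (1 / s) *\<^sub>R op_log (F s) - ?q s) \<longlongrightarrow> 0) (at 0)"
  proof (rule Lim_null_comparison)
    show "\<forall>\<^sub>F s in at 0. norm ((1 / s) *\<^sub>R op_log (F s) - ?q s) \<le> 8 * \<bar>s\<bar> * (norm (?q s))\<^sup>2"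
      using near sa
    proof eventually_elim
      case (elim s)
      have "norm ((1 / s) *\<^sub>R op_log (F s) - ?q s)
          = \<bar>1 / s\<bar> * norm (op_log (F s) - (F s - id_blinfun))"
        by (simp flip: scaleR_right_diff_distrib)
      also have "\<dots> \<le> \<bar>1 / s\<bar> * (8 * (norm (F s - id_blinfun))\<^sup>2)"
        using elim by (intro mult_left_mono op_log_near_id) auto
      also have "\<dots> = 8 * \<bar>s\<bar> * (norm (?q s))\<^sup>2"
      proof -
        have scale: "1 / a * (8 * n\<^sup>2) = 8 * a * (n / a)\<^sup>2" for a n :: real
          by (cases "a = 0") (simp_all add: power2_eq_square)
        show ?thesis using scale[of "\<bar>s\<bar>" "norm (F s - id_blinfun)"] by simp
      qed
      finally show ?case .
    qed
    have "((\<lambda>s. 8 * \<bar>s\<bar> * (norm (?q s))\<^sup>2) \<longlongrightarrow> 8 * \<bar>0\<bar> * (norm M)\<^sup>2) (at 0)"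
      by (intro tendsto_intros q)
    then show "((\<lambda>s. 8 * \<bar>s\<bar> * (norm (?q s))\<^sup>2) \<longlongrightarrow> 0) (at 0)" by simp
  qed
  from tendsto_add[OF this q] have "((\<lambda>s. (1 / s) *\<^sub>R op_log (F s)) \<longlongrightarrow> M) (at 0)" by simp
  then show ?thesis
    unfolding op_powr_def by (rule isCont_tendsto_compose[OF isCont_op_exp])
qed

theorem theorem6p1:
  fixes w :: "real ^ 'n"
    and G :: "'a::complex_hilbert_space oper ^ 'n \<Rightarrow> 'a oper"
  assumes "CARD('n) \<ge> 2"
    and "w \<in> prob_vectors"
    and "weighted_mean G"
    and "\<And>A. A \<in> PD_tuples \<Longrightarrow> harm_mean w A \<preceq>\<^sub>N G A \<and> G A \<preceq>\<^sub>N arith_mean w A"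
  shows "lie_trotter_mean w G"
  unfolding lie_trotter_mean_def
proof (intro conjI ballI allI impI assms(3))
  have has_derivative: "(G has_derivative arith_mean w) (at (\<chi> i. X) within PD_tuples)"
    if "X \<in> PD" for X
    by (rule near_order_mean_has_derivative[OF assms(2,3) _ that]) (rule assms(4))
  show "G differentiable at (\<chi> i. X) within PD_tuples" if "X \<in> PD" for X
    using has_derivative[OF that] by (rule differentiableI)
  have id_PD: "id_blinfun \<in> (PD :: 'a oper set)"
    using coercive_PD[of 1 "id_blinfun :: 'a oper"]
    by (simp add: coercive_def self_adjoint_id rinner_same)
  fix e :: real and \<gamma> :: "'n \<Rightarrow> real \<Rightarrow> 'a oper"
  assume e: "e > 0" and \<gamma>: "\<forall>i. \<gamma> i 0 = id_blinfun \<and>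
      (\<forall>s\<in>{-e<..<e}. \<gamma> i s \<in> PD \<and> \<gamma> i differentiable at s)"
  let ?I = "{-e<..<e}"
  let ?d = "\<lambda>i. vector_derivative (\<gamma> i) (at 0)"
  define \<Gamma> where "\<Gamma> = (\<lambda>s. \<chi> i. \<gamma> i s)"
  have \<Gamma>0: "\<Gamma> 0 = (\<chi> i. id_blinfun)" using \<gamma> by (simp add: \<Gamma>_def)
  have \<Gamma>_PD: "\<Gamma> s \<in> PD_tuples" if "s \<in> ?I" for s
    using \<gamma> that by (simp add: \<Gamma>_def PD_tuples_def)
  have "(\<gamma> i has_vector_derivative ?d i) (at 0)" for i
  proof -
    have "\<gamma> i differentiable at 0" using \<gamma> e by simp
    then show ?thesis by (rule vector_derivative_works[THEN iffD1])
  qed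
  then have "(\<Gamma> has_vector_derivative (\<chi> i. ?d i)) (at 0)"
    unfolding \<Gamma>_def by (rule has_vector_derivative_vec_lambda)
  then have "(\<Gamma> has_derivative (\<lambda>h. h *\<^sub>R (\<chi> i. ?d i))) (at 0 within ?I)"
    unfolding has_vector_derivative_def by (rule has_derivative_at_withinI)
  moreover have "(G has_derivative arith_mean w) (at (\<Gamma> 0) within \<Gamma> ` ?I)"
    unfolding \<Gamma>0 using has_derivative[OF id_PD] \<Gamma>_PD by (blast intro: has_derivative_subset)
  ultimately have "((\<lambda>s. G (\<Gamma> s)) has_derivative (\<lambda>h. arith_mean w (h *\<^sub>R (\<chi> i. ?d i))))
      (at 0 within ?I)"
    by (rule has_derivative_in_compose)
  moreover have "arith_mean w (h *\<^sub>R (\<chi> i. ?d i)) = h *\<^sub>R (\<Sum>i\<in>UNIV. w $ i *\<^sub>R ?d i)" for h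
    by (simp add: arith_mean_def scaleR_sum_right mult.commute)
  ultimately have *: "((\<lambda>s. G (\<Gamma> s)) has_vector_derivative (\<Sum>i\<in>UNIV. w $ i *\<^sub>R ?d i)) (at 0 within ?I)"
    by (simp add: has_vector_derivative_def)
  have "((\<lambda>s. G (\<Gamma> s)) has_vector_derivative (\<Sum>i\<in>UNIV. w $ i *\<^sub>R ?d i)) (at 0)"
  proof -
    have "at 0 within ?I = at 0" using e by (intro at_within_open) auto
    with * show ?thesis by (simp only:)
  qed
  moreover have "G (\<Gamma> 0) = id_blinfun"
    using assms(3) id_PD by (simp add: \<Gamma>0 weighted_mean_def)
  moreover have "\<forall>\<^sub>F s in at 0. self_adjoint (G (\<Gamma> s))"
  proof -
    have "\<forall>\<^sub>F s in at 0. s \<in> ?I"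
      using e by (intro eventually_at_in_open') auto
    then show ?thesis
      by eventually_elim (use assms(3) \<Gamma>_PD in \<open>simp add: weighted_mean_def PD_self_adjoint\<close>)
  qed
  ultimately show "((\<lambda>s. op_powr (G (\<chi> i. \<gamma> i s)) (1 / s))
      \<longlongrightarrow> op_exp (\<Sum>i\<in>UNIV. w $ i *\<^sub>R vector_derivative (\<gamma> i) (at 0))) (at 0)"
    using op_powr_curve_tendsto[of "\<lambda>s. G (\<Gamma> s)"] by (simp add: \<Gamma>_def)
qed

end
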